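(* Let $\mathrm{P}$ be a polymatroid on $E=\{1,\dots,m\}$ of type $\mathbf a$ and rank $r$, and let $S_1,\dots,S_r$ be a sequence of nonempty subsets of $E$. Then, in the augmented Chow ring $A^\bullet(\mathrm P)$, $$\deg_{\mathrm P}(h_{S_1}\cdots h_{S_r})=\begin{cases}1 & \text{if } S_1,\dots,S_r \text{ satisfies the Hall--Rado condition},\\ 0&\text{otherwise.}\end{cases}$$
   Context: Let $E=\{1,\dots,m\}$, $\mathbf a=(a_1,\dots,a_m)$ nonnegative integers, $n=a_1+\dots+a_m$. A polymatroid $\mathrm P$ on $E$ of type $\mathbf a$ is a function $\operatorname{rk}_{\mathrm P}:2^E\to\mathbb Z_{\ge0}$ that is submodular, monotone, satisfies $\operatorname{rk}_{\mathrm P}(\emptyset)=0$ and $\operatorname{rk}_{\mathrm P}(\{i\})\le a_i$; its rank is $\operatorname{rk}_{\mathrm P}(E)$. A flat of $\mathrm P$ is $F\subseteq E$ with $\operatorname{rk}_{\mathrm P}(F\cup\{e\})>\operatorname{rk}_{\mathrm P}(F)$ for all $e\notin F$. The sequence $S_1,\dots,S_r$ satisfies the Hall--Rado condition (w.r.t. $\mathrm P$) if $\operatorname{rk}_{\mathrm P}(\bigcup_{j\in J}S_j)\ge |J|$ for all $J\subseteq\{1,\dots,r\}$. Polystellahedral setup: let $\widetilde E$ be a set with $n$ elements and $\pi:\widetilde E\to E$ with $|\pi^{-1}(i)|=a_i$. Let $\mathbf e_j$ ($j\in\widetilde E$) be the standard basis of $\mathbb R^{\widetilde E}$ and $\mathbf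 e_U=\sum_{j\in U}\mathbf e_j$. A compatible pair $I\le\mathcal F$ consists of $I\subseteq\widetilde E$ and a chain $\mathcal F=\{F_1\subsetneq\dots\subsetneq F_k\subsetneq F_{k+1}=E\}$ ($k\ge0$) of subsets of $E$, such that whenever $\pi^{-1}(A)\subseteq I$ for some $A\subseteq E$, then $A\subseteq F_1$. The polystellahedral fan $\Sigma_{\mathbf a}$ in $\mathbb R^{\widetilde E}$ has cones $\sigma_{I\le\mathcal F}=\operatorname{cone}(-\mathbf e_{\widetilde E\setminus\pi^{-1}(F_1)},\dots,-\mathbf e_{\widetilde E\setminus\pi^{-1}(F_k)})+\operatorname{cone}(\mathbf e_j:j\in I)$; it is complete, projective and unimodular, and $X_{\mathbf a}$ denotes its smooth projective toric variety, with Chow ring $A^\bullet(X_{\mathbf a})$, $A_k(X_{\mathbf a})=A^{n-k}(X_{\mathbf a})$, and degree isomorphism $\deg_{X_{\mathbf a}}:A^n(X_{\mathbf a})\to\mathbb Z$. For $\emptyset\subseteq S\subsetneq E$, $x_S\in A^1(X_{\mathbf a})$ is the class of the torus-invariant divisor of the ray $\mathbb R_{\ge0}(-\mathbf e_{\widetilde E\setminus\pi^{-1}(S)})$. For nonempty $S\subseteq E$, $h_S=\sum_{T\subsetneq E,\,T\not\supseteq S}x_T$. Augmented Bergman class: $\Sigma_{\mathrm P}$ is the subfan of $\Sigma_{\mathbf a}$ consisting of the cones $\sigma_{S\le\mathcal F}$ with $S\subseteq\widetilde E$ and $\mathcal F=\{F_1\subsetneq\dots\subsetneq F_{k+1}=E\}$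 with $F_1,\dots,F_k$ proper flats of $\mathrm P$, such that (1) $\operatorname{rk}_{\mathrm P}(\pi(T))\ge|T|$ for all $T\subseteq S$, and (2) for all $F\in\mathcal F$ and all nonempty $T\subseteq S\setminus\pi^{-1}(F)$, $\operatorname{rk}_{\mathrm P}(F\cup\pi(T))>\operatorname{rk}_{\mathrm P}(F)+|T|$. It is a pure $r$-dimensional balanced fan; $[\Sigma_{\mathrm P}]\in A_r(X_{\mathbf a})$ is the class with $\deg_{X_{\mathbf a}}([\Sigma_{\mathrm P}]\cdot[Z_\sigma])=1$ if $\sigma\in\Sigma_{\mathrm P}$ and $0$ otherwise, for each $r$-dimensional cone $\sigma\in\Sigma_{\mathbf a}$, where $Z_\sigma$ is the torus-orbit closure of $\sigma$. The augmented Chow ring is $A^\bullet(\mathrm P)=A^\bullet(X_{\mathbf a})/\operatorname{ann}([\Sigma_{\mathrm P}])$, with $\deg_{\mathrm P}(\xi)=\deg_{X_{\mathbf a}}(\xi'\cdot[\Sigma_{\mathrm P}])$ for any lift $\xi'$ of $\xi$; $h_S\in A^1(\mathrm P)$ also denotes the image of $h_S$. *)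

theory Defs
  imports Main "HOL-Library.Poly_Mapping"
begin

(* Ground set E = {1..m}; type a :: nat => nat (only a i for i in E matters).
   E~ is realised concretely as the set of pairs (i,k), i in E, k < a i, with pi = fst. *)

definition Etil :: "nat \<Rightarrow> (nat \<Rightarrow> nat) \<Rightarrow> (nat \<times> nat) set" where
  "Etil m a = {(i,k). i \<in> {1..m} \<and> k < a i}"

definition preim :: "nat \<Rightarrow> (nat \<Rightarrow> nat) \<Rightarrow> nat set \<Rightarrow> (nat \<times> nat) set" where
  "preim m a A = {j \<in> Etil m a. fst j \<in> A}"

definition polymatroid :: "nat \<Rightarrow> (nat \<Rightarrow> nat) \<Rightarrow> (nat set \<Rightarrow> nat) \<Rightarrow> bool" where
  "polymatroid m a rk \<longleftrightarrow>
     rk {} = 0 \<and>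
     (\<forall>A B. A \<subseteq> {1..m} \<longrightarrow> B \<subseteq> {1..m} \<longrightarrow> rk (A \<union> B) + rk (A \<inter> B) \<le> rk A + rk B) \<and>
     (\<forall>A B. A \<subseteq> B \<longrightarrow> B \<subseteq> {1..m} \<longrightarrow> rk A \<le> rk B) \<and>
     (\<forall>i\<in>{1..m}. rk {i} \<le> a i)"

definition is_flat :: "nat \<Rightarrow> (nat set \<Rightarrow> nat) \<Rightarrow> nat set \<Rightarrow> bool" where
  "is_flat m rk F \<longleftrightarrow> F \<subseteq> {1..m} \<and> (\<forall>e \<in> {1..m} - F. rk (insert e F) > rk F)"

definition hall_rado :: "(nat set \<Rightarrow> nat) \<Rightarrow> nat \<Rightarrow> (nat \<Rightarrow> nat set) \<Rightarrow> bool" where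
  "hall_rado rk r S \<longleftrightarrow> (\<forall>J \<subseteq> {1..r}. card J \<le> rk (\<Union>j\<in>J. S j))"

(* Labels of the rays of the polystellahedral fan:
   Pos j  : the ray e_j (j in E~),
   Neg S  : the ray -e_{E~ \ pi^{-1}(S)} (S a proper subset of E). *)
datatype lbl = Pos "nat \<times> nat" | Neg "nat set"

(* Compatible pair I <= F, where the chain F = C \<union> {E}, C = {F_1,...,F_k} proper subsets *)
definition compatible :: "nat \<Rightarrow> (nat \<Rightarrow> nat) \<Rightarrow> (nat \<times> nat) set \<Rightarrow> nat set set \<Rightarrow> bool" where
  "compatible m a I C \<longleftrightarrow>
     I \<subseteq> Etil m a \<and>
     (\<forall>F\<in>C. F \<subset> {1..m}) \<and>
     (\<forall>F\<in>C. \<forall>G\<in>C. F \<subseteq> G \<or> G \<subseteq> F) \<and>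
     (\<forall>A. A \<subseteq> {1..m} \<longrightarrow> preim m a A \<subseteq> I \<longrightarrow> (\<forall>F\<in>C. A \<subseteq> F))"

definition cone_rays :: "(nat \<times> nat) set \<Rightarrow> nat set set \<Rightarrow> lbl set" where
  "cone_rays I C = Pos ` I \<union> Neg ` C"

definition is_cone :: "nat \<Rightarrow> (nat \<Rightarrow> nat) \<Rightarrow> lbl set \<Rightarrow> bool" where
  "is_cone m a R \<longleftrightarrow> (\<exists>I C. compatible m a I C \<and> R = cone_rays I C)"

type_synonym cpoly = "(lbl \<Rightarrow>\<^sub>0 nat) \<Rightarrow>\<^sub>0 int"

definition Var :: "lbl \<Rightarrow> cpoly" where
  "Var \<rho> = Poly_Mapping.single (Poly_Mapping.single \<rho> 1) 1"

definition monom :: "lbl set \<Rightarrow> cpoly" where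
  "monom R = (\<Prod>\<rho>\<in>R. Var \<rho>)"

definition hom_deg :: "nat \<Rightarrow> cpoly \<Rightarrow> bool" where
  "hom_deg d f \<longleftrightarrow> (\<forall>\<mu> \<in> Poly_Mapping.keys f. (\<Sum>\<rho>\<in>Poly_Mapping.keys \<mu>. Poly_Mapping.lookup \<mu> \<rho>) = d)"

inductive_set ideal_of :: "'a::comm_ring_1 set \<Rightarrow> 'a set" for G where
  zero: "0 \<in> ideal_of G"
| step: "g \<in> G \<Longrightarrow> x \<in> ideal_of G \<Longrightarrow> c * g + x \<in> ideal_of G"

(* Stanley--Reisner relations and linear relations of the toric variety X_a *)
definition chow_rels :: "nat \<Rightarrow> (nat \<Rightarrow> nat) \<Rightarrow> cpoly set" where
  "chow_rels m a =
     {monom R | R. finite R \<and> \<not> is_cone m a R} \<union>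
     {Var (Pos j) - (\<Sum>S \<in> {S. S \<subset> {1..m} \<and> fst j \<notin> S}. Var (Neg S)) | j. j \<in> Etil m a}"

(* deg_{X_a}: A^n(X_a) -> Z, normalised by deg of the class of a point
   (product of the rays of the maximal cone cone(e_j : j in E~)) being 1 *)
definition deg_X :: "nat \<Rightarrow> (nat \<Rightarrow> nat) \<Rightarrow> cpoly \<Rightarrow> int" where
  "deg_X m a f = (THE c::int. f - of_int c * monom (Pos ` Etil m a) \<in> ideal_of (chow_rels m a))"

definition x_S :: "nat set \<Rightarrow> cpoly" where
  "x_S S = Var (Neg S)"

definition h_S :: "nat \<Rightarrow> nat set \<Rightarrow> cpoly" where
  "h_S m S = (\<Sum>T \<in> {T. T \<subset> {1..m} \<and> \<not> S \<subseteq> T}. x_S T)"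

definition in_SigmaP :: "nat \<Rightarrow> (nat \<Rightarrow> nat) \<Rightarrow> (nat set \<Rightarrow> nat) \<Rightarrow> lbl set \<Rightarrow> bool" where
  "in_SigmaP m a rk R \<longleftrightarrow>
     (\<exists>I C. compatible m a I C \<and> R = cone_rays I C \<and>
        (\<forall>F\<in>C. is_flat m rk F) \<and>
        (\<forall>T \<subseteq> I. rk (fst ` T) \<ge> card T) \<and>
        (\<forall>F \<in> insert {1..m} C. \<forall>T. T \<subseteq> I - preim m a F \<longrightarrow> T \<noteq> {} \<longrightarrow>
            rk (F \<union> fst ` T) > rk F + card T))"

(* c represents the augmented Bergman class [Sigma_P] in A_r(X_a) = A^{n-r}(X_a) *)
definition bergman_class :: "nat \<Rightarrow> (nat \<Rightarrow> nat) \<Rightarrow> (nat set \<Rightarrow> nat) \<Rightarrow> cpoly \<Rightarrow> bool" where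
  "bergman_class m a rk c \<longleftrightarrow>
     hom_deg (card (Etil m a) - rk {1..m}) c \<and>
     (\<forall>R. is_cone m a R \<longrightarrow> card R = rk {1..m} \<longrightarrow>
         deg_X m a (c * monom R) = (if in_SigmaP m a rk R then 1 else 0))"

(* deg_P(xi) = deg_{X_a}(xi' * [Sigma_P]) for a lift xi' *)
definition deg_P :: "nat \<Rightarrow> (nat \<Rightarrow> nat) \<Rightarrow> (nat set \<Rightarrow> nat) \<Rightarrow> cpoly \<Rightarrow> int" where
  "deg_P m a rk \<xi> = (THE d. \<forall>c. bergman_class m a rk c \<longrightarrow> deg_X m a (\<xi> * c) = d)"

end

theory Submission
  imports Defs "HOL-Library.Multiset"
begin

text \<open>
  In the variables $h_S$ the degree functional of a polymatroid is simply declared to be the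
  indicator of the Hall--Rado condition on monomials of degree equal to the rank. Removing one
  factor $h_S$ amounts to replacing the rank function by the truncation
  $A \mapsto \min(\mathrm{rk}(A), \mathrm{rk}(A \cup S) - 1)$, so all evaluations reduce to small rank,
  and after expressing $x_F$ as an alternating sum of the $h_S$ with $S \supseteq F$ they become
  cancellations in alternating sums over intervals of subsets. In this way the functional kills the
  Stanley--Reisner relations, and it takes on each squarefree cone monomial the value prescribed
  by the augmented Bergman fan.

  For the free polymatroid $A \mapsto \sum_{i \in A} a_i$ the functional is the degree map of the toric
  variety, because the top degree of the Chow ring is spanned by the class of a point. A representative
  of the Bergman class is the product over $s < n - r$ of the divisors
  $\sum x_T$, where $T$ ranges over the proper subsets with $\sum_{i \in T} a_i - \mathrm{rk}(T) \le s$: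
  multiplication by these divisors leads from the free polymatroid down to the given one through
  its Higgs lifts. Since squarefree cone monomials span each degree, every representative of the
  Bergman class gives the same functional.
\<close>

text \<open>Both degree maps are definite descriptions, so they say nothing until existence and
  uniqueness are shown. Uniqueness of the integer in \<open>deg_X\<close> needs a functional that
  kills all relations but not a point. For \<open>deg_P\<close> a Bergman class must exist as a
  polynomial, since otherwise every integer would meet the defining condition. The Hall--Rado
  functional serves both purposes. It lives on a free polynomial ring in the h_S, where it can be
  prescribed on monomials without any consistency check. After substituting h_S for the rays the
  linear relations become identities, and only the Stanley--Reisner monomials are left to kill. The
  obstacle is that x_F becomes a signed sum over all supersets of F, so products of several x_F
  cannot be evaluated head-on. Two devices avoid this: toggling one element e outside F is a
  sign-reversing involution on that sum, and truncation absorbs all remaining h-factors into a new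
  polymatroid of small rank. Spanning by squarefree cone monomials does the work that Poincare
  duality of X_a would do.\<close>

lemma ideal_of_add: "x \<in> ideal_of G \<Longrightarrow> y \<in> ideal_of G \<Longrightarrow> x + y \<in> ideal_of G"
  by (induction x rule: ideal_of.induct) (simp_all add: add.assoc ideal_of.step)

lemma ideal_of_mult: "x \<in> ideal_of G \<Longrightarrow> d * x \<in> ideal_of G"
proof (induction x rule: ideal_of.induct)
  case (step g x c)
  have "(d * c) * g + d * x \<in> ideal_of G"
    by (intro ideal_of.step step)
  then show ?case by (simp add: algebra_simps)
qed (simp add: ideal_of.zero)

lemma ideal_of_gen: "g \<in> G \<Longrightarrow> g \<in> ideal_of G"
  using ideal_of.step[OF _ ideal_of.zero, of g G 1] by simp

lemma ideal_of_uminus: "x \<in> ideal_of G \<Longrightarrow> - x \<in> ideal_of G"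
  using ideal_of_mult[of x G "-1"] by simp

lemma ideal_of_diff: "x \<in> ideal_of G \<Longrightarrow> y \<in> ideal_of G \<Longrightarrow> x - y \<in> ideal_of G"
  using ideal_of_add[of x G "- y"] ideal_of_uminus by auto

lemma ideal_of_sum: "(\<And>i. i \<in> A \<Longrightarrow> f i \<in> ideal_of G) \<Longrightarrow> sum f A \<in> ideal_of G"
  by (induction A rule: infinite_finite_induct) (auto intro: ideal_of_add ideal_of.zero)


section \<open>Linear functionals and substitutions on polynomials\<close>

text \<open>The Z-linear extension of a weight on keys. It serves twice: with an arbitrary weight it
  is a functional on the h-polynomials, and with a multiplicative weight it is a ring homomorphism,
  used for the substitution of the rays.\<close>

definition lin :: "('k \<Rightarrow> 'b::comm_ring_1) \<Rightarrow> ('k \<Rightarrow>\<^sub>0 int) \<Rightarrow> 'b" where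
  "lin w f = (\<Sum>k\<in>Poly_Mapping.keys f. of_int (Poly_Mapping.lookup f k) * w k)"

lemma lin_superset:
  "finite K \<Longrightarrow> Poly_Mapping.keys f \<subseteq> K \<Longrightarrow>
    lin w f = (\<Sum>k\<in>K. of_int (Poly_Mapping.lookup f k) * w k)"
  unfolding lin_def by (rule sum.mono_neutral_left) (auto simp: in_keys_iff)

lemma lin_zero [simp]: "lin w 0 = 0"
  by (simp add: lin_def)

lemma lin_single [simp]: "lin w (Poly_Mapping.single k c) = of_int c * w k"
  by (simp add: lin_def)

lemma lin_add: "lin w (f + g) = lin w f + lin w g"
proof -
  let ?K = "Poly_Mapping.keys f \<union> Poly_Mapping.keys g"
  have "lin w (f + g) = (\<Sum>k\<in>?K. of_int (Poly_Mapping.lookup (f + g) k) * w k)"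
    by (rule lin_superset) (auto simp: in_keys_iff lookup_add)
  moreover have "lin w f = (\<Sum>k\<in>?K. of_int (Poly_Mapping.lookup f k) * w k)"
    "lin w g = (\<Sum>k\<in>?K. of_int (Poly_Mapping.lookup g k) * w k)"
    by (rule lin_superset; auto)+
  ultimately show ?thesis
    by (simp add: lookup_add algebra_simps sum.distrib)
qed

lemma lin_uminus: "lin w (- f) = - lin w f"
  using lin_add[of w f "- f"] by (simp add: eq_neg_iff_add_eq_0 add.commute)

lemma lin_diff: "lin w (f - g) = lin w f - lin w g"
  using lin_add[of w f "- g"] by (simp add: lin_uminus)

lemma lin_sum: "lin w (sum f A) = (\<Sum>i\<in>A. lin w (f i))"
  by (induction A rule: infinite_finite_induct) (auto simp: lin_add)

lemma lin_neg_one_power: "lin w ((-1) ^ k * f) = (-1) ^ k * lin w f"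
  by (induction k) (auto simp: lin_uminus)

lemma poly_mapping_expand:
  "f = (\<Sum>k\<in>Poly_Mapping.keys f. Poly_Mapping.single k (Poly_Mapping.lookup f k))"
proof (rule poly_mapping_eqI)
  fix k
  show "Poly_Mapping.lookup f k =
    Poly_Mapping.lookup (\<Sum>k\<in>Poly_Mapping.keys f. Poly_Mapping.single k (Poly_Mapping.lookup f k)) k"
    by (auto simp: lookup_sum lookup_single when_def in_keys_iff)
qed

lemma single_eq_of_int_mult:
  "Poly_Mapping.single k c = of_int c * Poly_Mapping.single (k::'k::comm_monoid_add) (1::int)"
  by (simp add: mult_single flip: single_of_int)

lemma lin_of_int_mult: "lin w (of_int c * f) = of_int c * lin w f"
proof (induction c rule: int_induct[where k = 0])
  case base
  then show ?case by simp
next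
  case (step1 i)
  then show ?case by (simp add: algebra_simps lin_add)
next
  case (step2 i)
  then show ?case by (simp add: algebra_simps lin_diff)
qed

lemma lin_mult_expand:
  "lin w (f * g) = (\<Sum>k\<in>Poly_Mapping.keys g.
     of_int (Poly_Mapping.lookup g k) * lin w (f * Poly_Mapping.single (k::'k::comm_monoid_add) 1))"
proof -
  have "f * g = (\<Sum>k\<in>Poly_Mapping.keys g.
      of_int (Poly_Mapping.lookup g k) * (f * Poly_Mapping.single k 1))"
    by (subst poly_mapping_expand[of g], subst single_eq_of_int_mult)
       (simp add: sum_distrib_left mult_ac)
  then show ?thesis by (simp add: lin_sum lin_of_int_mult)
qed

text \<open>By linearity in the multiplier it suffices to test monomials. This turns identities
  between degree functionals into statements about single multisets; the weights and the fixed
  factors on the two sides may differ.\<close>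

lemma lin_mult_eqI:
  assumes "\<And>k. lin w (f * Poly_Mapping.single (k::'k::comm_monoid_add) 1)
                  = lin v (g * Poly_Mapping.single k 1)"
  shows "lin w (f * h) = lin v (g * h)"
  by (simp add: lin_mult_expand[of _ _ h] assms)

lemma lin_mult_zeroI:
  assumes "\<And>k. lin w (f * Poly_Mapping.single (k::'k::comm_monoid_add) 1) = 0"
  shows "lin w (f * h) = 0"
  by (simp add: lin_mult_expand[of _ _ h] assms)

lemma lin_mult:
  assumes "\<And>k l. w (k + l) = w k * w (l::'k::comm_monoid_add)"
  shows "lin w (f * g) = lin w f * lin w g"
proof -
  have *: "lin w (f * Poly_Mapping.single k 1) = lin w f * w k" for k
  proof -
    have "lin w (f * Poly_Mapping.single k 1) = lin w (Poly_Mapping.single k 1 * f)"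
      by (simp add: mult.commute)
    also have "\<dots> = lin w f * w k"
      by (subst lin_mult_expand) (simp add: mult_single assms lin_def sum_distrib_left mult_ac)
    finally show ?thesis .
  qed
  show ?thesis
    by (subst lin_mult_expand) (simp add: * lin_def[of w g] sum_distrib_left mult_ac)
qed


section \<open>Alternating sums over intervals of subsets\<close>

text \<open>Pairing S with \<open>insert e S\<close> reverses the sign and preserves f. The shift n
  leaves room for the factor from \<open>card F\<close> in the Moebius inversion formula.\<close>

lemma sum_cancel_insert:
  fixes f :: "'a set \<Rightarrow> 'b::comm_ring_1"
  assumes "finite B" "e \<in> B" "e \<notin> A"
    and f: "\<And>S. A \<subseteq> S \<Longrightarrow> S \<subseteq> B \<Longrightarrow> e \<notin> S \<Longrightarrow> f (insert e S) = f S"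
  shows "(\<Sum>S | A \<subseteq> S \<and> S \<subseteq> B. (-1) ^ (n + card S) * f S) = 0"
proof -
  let ?X = "{S. A \<subseteq> S \<and> S \<subseteq> B \<and> e \<notin> S}"
  have fin: "finite ?X" "finite (insert e ` ?X)"
    using assms(1) by (auto intro: finite_subset[of _ "Pow B"])
  have "{S. A \<subseteq> S \<and> S \<subseteq> B} = ?X \<union> insert e ` ?X"
  proof (intro equalityI subsetI)
    fix S assume S: "S \<in> {S. A \<subseteq> S \<and> S \<subseteq> B}"
    show "S \<in> ?X \<union> insert e ` ?X"
    proof (cases "e \<in> S")
      case True
      then have "S = insert e (S - {e})" "S - {e} \<in> ?X" using S assms(3) by auto
      then show ?thesis by blast
    qed (use S in auto)
  qed (use assms in auto)
  then have "(\<Sum>S | A \<subseteq> S \<and> S \<subseteq> B. (-1) ^ (n + card S) * f S) =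
      (\<Sum>S\<in>?X. (-1) ^ (n + card S) * f S) + (\<Sum>S\<in>insert e ` ?X. (-1) ^ (n + card S) * f S)"
    using fin by (simp only:) (rule sum.union_disjoint, auto)
  also have "(\<Sum>S\<in>insert e ` ?X. (-1) ^ (n + card S) * f S)
      = (\<Sum>S\<in>?X. (-1) ^ (n + card (insert e S)) * f (insert e S))"
    by (subst sum.reindex) (auto simp: inj_on_def dest: insert_ident[THEN iffD1, rotated 2])
  also have "\<dots> = - (\<Sum>S\<in>?X. (-1) ^ (n + card S) * f S)"
    unfolding sum_negf[symmetric]
  proof (rule sum.cong)
    fix S assume S: "S \<in> ?X"
    then have "finite S" using assms(1) finite_subset by auto
    then show "(-1) ^ (n + card (insert e S)) * f (insert e S) = - ((-1) ^ (n + card S) * f S)"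
      using S f[of S] by simp
  qed simp
  finally show ?thesis by simp
qed

lemma sum_alternating_interval:
  assumes "finite B"
  shows "(\<Sum>S | A \<subseteq> S \<and> S \<subseteq> B. (-1) ^ (n + card S)) = (if A = B then (-1) ^ (n + card B) else (0::'b::comm_ring_1))"
proof (cases "A \<subseteq> B")
  case True
  show ?thesis
  proof (cases "A = B")
    case True
    then have "{S. A \<subseteq> S \<and> S \<subseteq> B} = {B}" by auto
    then show ?thesis using True by simp
  next
    case False
    then obtain e where "e \<in> B" "e \<notin> A" using True by auto
    then show ?thesis using False sum_cancel_insert[of B e A "\<lambda>_. 1::'b" n] assms by simp
  qed
next
  case False
  then have "{S. A \<subseteq> S \<and> S \<subseteq> B} = {}" by auto
  then show ?thesis using False by (auto simp del: Collect_empty_eq)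
qed

section \<open>Polymatroids and the Hall--Rado condition\<close>

lemma polymatroid_submod:
  "polymatroid m a rk \<Longrightarrow> A \<subseteq> {1..m} \<Longrightarrow> B \<subseteq> {1..m} \<Longrightarrow> rk (A \<union> B) + rk (A \<inter> B) \<le> rk A + rk B"
  by (simp add: polymatroid_def)

lemma polymatroid_mono:
  "polymatroid m a rk \<Longrightarrow> A \<subseteq> B \<Longrightarrow> B \<subseteq> {1..m} \<Longrightarrow> rk A \<le> rk B"
  by (simp add: polymatroid_def)

lemma polymatroid_empty: "polymatroid m a rk \<Longrightarrow> rk {} = 0"
  by (simp add: polymatroid_def)

lemma polymatroid_singleton: "polymatroid m a rk \<Longrightarrow> i \<in> {1..m} \<Longrightarrow> rk {i} \<le> a i"
  by (simp add: polymatroid_def)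

text \<open>Submodularity as diminishing returns: the gain from adding e cannot grow when A is
  enlarged, so an element of the closure of A stays in the closure of B.\<close>

lemma polymatroid_closure_mono:
  assumes "polymatroid m a rk" "A \<subseteq> B" "B \<subseteq> {1..m}" "e \<in> {1..m}" "rk (insert e A) = rk A"
  shows "rk (insert e B) = rk B"
proof (cases "e \<in> B")
  case False
  have "rk (insert e A \<union> B) + rk (insert e A \<inter> B) \<le> rk (insert e A) + rk B"
    using assms by (intro polymatroid_submod[OF assms(1)]) auto
  moreover have "insert e A \<union> B = insert e B" "insert e A \<inter> B = A"
    using assms(2) False by auto
  moreover have "rk B \<le> rk (insert e B)"
    using assms by (intro polymatroid_mono[OF assms(1)]) auto
  ultimately show ?thesis using assms(5) by simp
qed (simp add: insert_absorb)

lemma flat_rank_less: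
  assumes "polymatroid m a rk" "is_flat m rk F" "G \<subseteq> {1..m}" "\<not> G \<subseteq> F"
  shows "rk F < rk (F \<union> G)"
proof -
  obtain e where e: "e \<in> G" "e \<notin> F" using assms(4) by auto
  then have "rk F < rk (insert e F)" using assms by (auto simp: is_flat_def)
  also have "\<dots> \<le> rk (F \<union> G)"
    using assms e by (intro polymatroid_mono[OF assms(1)]) (auto simp: is_flat_def)
  finally show ?thesis .
qed

lemma flat_psubset_rank_less:
  "polymatroid m a rk \<Longrightarrow> is_flat m rk F \<Longrightarrow> F \<subset> G \<Longrightarrow> G \<subseteq> {1..m} \<Longrightarrow> rk F < rk G"
  using flat_rank_less[of m a rk F G] by (auto simp: Un_absorb1)


section \<open>Principal truncation and Hall--Rado multisets\<close>

text \<open>The principal truncation: put a point p generically on S and contract it. Adding p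
  raises the rank of A by 1 unless S lies in the closure of A, and subtracting the rank 1 of p gives
  the minimum. The natural subtraction is honest once \<open>1 \<le> rk S\<close>.\<close>

definition trunc :: "(nat set \<Rightarrow> nat) \<Rightarrow> nat set \<Rightarrow> nat set \<Rightarrow> nat" where
  "trunc rk S A = min (rk A) (rk (A \<union> S) - 1)"

lemma polymatroid_trunc:
  assumes P: "polymatroid m a rk" and S: "S \<subseteq> {1..m}" "1 \<le> rk S"
  shows "polymatroid m a (trunc rk S)"
  unfolding polymatroid_def
proof (intro conjI allI impI ballI)
  note mono = polymatroid_mono[OF P] and sub = polymatroid_submod[OF P]
  show "trunc rk S {} = 0"
    using polymatroid_empty[OF P] by (simp add: trunc_def)
  show "trunc rk S {i} \<le> a i" if "i \<in> {1..m}" for i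
    using polymatroid_singleton[OF P that] by (simp add: trunc_def)
  show "trunc rk S A \<le> trunc rk S B" if "A \<subseteq> B" "B \<subseteq> {1..m}" for A B
  proof -
    have "rk A \<le> rk B" "rk (A \<union> S) \<le> rk (B \<union> S)"
      using that S by (auto intro!: mono)
    then show ?thesis by (auto simp: trunc_def)
  qed
  show "trunc rk S (A \<union> B) + trunc rk S (A \<inter> B) \<le> trunc rk S A + trunc rk S B"
    if AB: "A \<subseteq> {1..m}" "B \<subseteq> {1..m}" for A B
  proof -
    have pos: "1 \<le> rk (X \<union> S)" if "X \<subseteq> {1..m}" for X
      using mono[of S "X \<union> S"] that S by auto
    \<comment> \<open>The right-hand side is a sum of two minima. Each of the four choices of
      attained terms is bounded below by one of the inequalities 1 to 4.\<close>
    have 1: "rk (A \<union> B) + rk (A \<inter> B) \<le> rk A + rk B"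
      by (rule sub[OF AB])
    have 2: "rk (X \<union> Y \<union> S) + rk (X \<inter> Y) \<le> rk (X \<union> S) + rk Y"
      if XY: "X \<subseteq> {1..m}" "Y \<subseteq> {1..m}" for X Y
    proof -
      have "rk (X \<union> S \<union> Y) + rk ((X \<union> S) \<inter> Y) \<le> rk (X \<union> S) + rk Y"
        using XY S by (intro sub) auto
      moreover have "rk (X \<inter> Y) \<le> rk ((X \<union> S) \<inter> Y)"
        using XY S by (intro mono) auto
      moreover have "X \<union> S \<union> Y = X \<union> Y \<union> S" by auto
      ultimately show ?thesis by simp
    qed
    have 3: "rk (A \<union> B \<union> S) + rk (A \<inter> B \<union> S) \<le> rk (A \<union> S) + rk (B \<union> S)"
    proof -
      have "rk ((A \<union> S) \<union> (B \<union> S)) + rk ((A \<union> S) \<inter> (B \<union> S)) \<le> rk (A \<union> S) + rk (B \<union> S)"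
        using AB S by (intro sub) auto
      moreover have "(A \<union> S) \<union> (B \<union> S) = A \<union> B \<union> S" "(A \<union> S) \<inter> (B \<union> S) = A \<inter> B \<union> S" by auto
      ultimately show ?thesis by simp
    qed
    have 4: "rk (A \<union> B \<union> S) + rk (A \<inter> B) \<le> rk (B \<union> S) + rk A"
      using 2[OF AB(2,1)] by (simp add: Un_commute Int_commute)
    have "1 \<le> rk (A \<union> S)" "1 \<le> rk (B \<union> S)" "1 \<le> rk (A \<union> B \<union> S)" "1 \<le> rk (A \<inter> B \<union> S)"
      using AB by (intro pos; blast)+
    then show ?thesis
      using 1 2[OF AB] 3 4 unfolding trunc_def by linarith
  qed
qed


text \<open>A multiset $\{S_1,\dots,S_k\}$ stands for the monomial $h_{S_1}\cdots h_{S_k}$.\<close>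

definition hr :: "(nat set \<Rightarrow> nat) \<Rightarrow> nat set multiset \<Rightarrow> bool" where
  "hr rk M \<longleftrightarrow> (\<forall>N. N \<subseteq># M \<longrightarrow> size N \<le> rk (\<Union> (set_mset N)))"

text \<open>Degrees other than the rank get weight 0, so the functional is total and needs no
  homogeneity side conditions; the test on members is there because the multiset type does not know
  the ground set.\<close>

definition hr_weight :: "nat \<Rightarrow> (nat set \<Rightarrow> nat) \<Rightarrow> nat set multiset \<Rightarrow> int" where
  "hr_weight m rk M =
     (if (\<forall>S\<in>#M. S \<subseteq> {1..m}) \<and> size M = rk {1..m} \<and> hr rk M then 1 else 0)"

lemma subseteq_add_mset_cases:
  "N \<subseteq># add_mset x M \<longleftrightarrow> N \<subseteq># M \<or> (\<exists>N'. N = add_mset x N' \<and> N' \<subseteq># M)"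
proof
  assume N: "N \<subseteq># add_mset x M"
  show "N \<subseteq># M \<or> (\<exists>N'. N = add_mset x N' \<and> N' \<subseteq># M)"
  proof (cases "x \<in># N")
    case True
    then obtain N' where "N = add_mset x N'" by (meson multi_member_split)
    then show ?thesis using N by auto
  next
    case False
    have "count N y \<le> count M y" for y
      using mset_subset_eq_count[OF N, of y] False by (cases "y = x") (auto simp: not_in_iff)
    then show ?thesis by (simp add: subseteq_mset_def)
  qed
next
  assume "N \<subseteq># M \<or> (\<exists>N'. N = add_mset x N' \<and> N' \<subseteq># M)"
  then show "N \<subseteq># add_mset x M"
    by (metis add_mset_remove_trivial mset_subset_eq_add_mset_cancel diff_subset_eq_self subset_mset.order_trans)
qed

lemma hr_add_mset:
  "hr rk (add_mset S M) \<longleftrightarrow>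
    hr rk M \<and> (\<forall>N. N \<subseteq># M \<longrightarrow> Suc (size N) \<le> rk (S \<union> \<Union> (set_mset N)))"
  unfolding hr_def subseteq_add_mset_cases by auto

lemma hr_subset: "hr rk M \<Longrightarrow> N \<subseteq># M \<Longrightarrow> hr rk N"
  unfolding hr_def by (meson subset_mset.order_trans)

lemma Union_mset_subset:
  "\<forall>S\<in>#M. S \<subseteq> E \<Longrightarrow> N \<subseteq># M \<Longrightarrow> \<Union> (set_mset N) \<subseteq> E"
  by (meson Union_least mset_subset_eqD)

text \<open>A submultiset of \<open>add_mset S M\<close> is N or S together with N, for some N in M.
  The two resulting bounds on \<open>size N\<close> are exactly the two arguments of the minimum in
  \<open>trunc rk S\<close>.\<close>

lemma hr_trunc:
  assumes P: "polymatroid m a rk" and S: "S \<subseteq> {1..m}" and M: "\<forall>S\<in>#M. S \<subseteq> {1..m}"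
  shows "hr rk (add_mset S M) \<longleftrightarrow> 1 \<le> rk S \<and> hr (trunc rk S) M"
proof
  assume h: "hr rk (add_mset S M)"
  then have h': "hr rk M" and h'': "\<And>N. N \<subseteq># M \<Longrightarrow> Suc (size N) \<le> rk (S \<union> \<Union> (set_mset N))"
    by (auto simp: hr_add_mset)
  have "1 \<le> rk S" using h''[of "{#}"] by simp
  moreover have "hr (trunc rk S) M"
    unfolding hr_def trunc_def using h' h'' by (fastforce simp: hr_def Un_commute)
  ultimately show "1 \<le> rk S \<and> hr (trunc rk S) M" by simp
next
  assume h: "1 \<le> rk S \<and> hr (trunc rk S) M"
  have "Suc (size N) \<le> rk (S \<union> \<Union> (set_mset N)) \<and> size N \<le> rk (\<Union> (set_mset N))" if N: "N \<subseteq># M" for N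
  proof -
    have "size N \<le> trunc rk S (\<Union> (set_mset N))" using h N by (auto simp: hr_def)
    moreover have "rk S \<le> rk (\<Union> (set_mset N) \<union> S)"
      using Union_mset_subset[OF M N] S by (intro polymatroid_mono[OF P]) auto
    ultimately show ?thesis using h by (auto simp: trunc_def Un_commute)
  qed
  then show "hr rk (add_mset S M)" unfolding hr_add_mset by (simp add: hr_def)
qed

lemma trunc_top:
  "polymatroid m a rk \<Longrightarrow> S \<subseteq> {1..m} \<Longrightarrow> trunc rk S {1..m} = rk {1..m} - 1"
  by (simp add: trunc_def Un_absorb2)

lemma hr_weight_add_mset:
  assumes P: "polymatroid m a rk" and S: "S \<subseteq> {1..m}"
  shows "hr_weight m rk (add_mset S M) = (if 1 \<le> rk S then hr_weight m (trunc rk S) M else 0)"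
proof -
  have "rk S \<le> rk {1..m}" using P S by (intro polymatroid_mono) auto
  then show ?thesis
    using hr_trunc[OF P S, of M] trunc_top[OF P S] S by (auto simp: hr_weight_def)
qed

lemma hr_weight_empty_mem: "polymatroid m a rk \<Longrightarrow> hr_weight m rk (add_mset {} M) = 0"
  using hr_weight_add_mset[of m a rk "{}" M] by (simp add: polymatroid_empty)

text \<open>The last clause says $Q(A) = \min_{N \subseteq M} (\mathrm{rk}(A \cup \bigcup N) - |N|)$.\<close>

lemma truncation_exists:
  assumes "polymatroid m a rk" "\<forall>S\<in>#M. S \<subseteq> {1..m}" "hr rk M"
  obtains Q where "polymatroid m a Q" "\<And>N. hr_weight m rk (M + N) = hr_weight m Q N"
    "\<And>A k. A \<subseteq> {1..m} \<Longrightarrow>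
       k \<le> Q A \<longleftrightarrow> (\<forall>N. N \<subseteq># M \<longrightarrow> k + size N \<le> rk (A \<union> \<Union> (set_mset N)))"
  using assms
proof (induction M arbitrary: rk thesis)
  case empty
  then show ?case by simp
next
  case (add S M)
  have S: "S \<subseteq> {1..m}" and M: "\<forall>S\<in>#M. S \<subseteq> {1..m}" using add.prems by auto
  have *: "1 \<le> rk S" "hr (trunc rk S) M"
    using add.prems hr_trunc[OF _ S M] by auto
  note P = polymatroid_trunc[OF add.prems(2) S *(1)]
  show ?case
  proof (rule add.IH[OF _ P M *(2)])
    fix Q assume Q: "polymatroid m a Q" "\<And>N. hr_weight m (trunc rk S) (M + N) = hr_weight m Q N"
      "\<And>A k. A \<subseteq> {1..m} \<Longrightarrow> (k \<le> Q A) =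
         (\<forall>N. N \<subseteq># M \<longrightarrow> k + size N \<le> trunc rk S (A \<union> \<Union> (set_mset N)))"
    show ?case
    proof (rule add.prems(1)[OF Q(1)])
      show "hr_weight m rk (add_mset S M + N) = hr_weight m Q N" for N
        using hr_weight_add_mset[OF add.prems(2) S, of "M + N"] * Q(2) by simp
      fix A k assume A: "A \<subseteq> {1..m}"
      \<comment> \<open>Positivity makes the \<open>- 1\<close> in \<open>trunc\<close> equivalent
        to \<open>Suc\<close> on the other side of the inequality; this is also why the clause is
        phrased by thresholds k instead of by differences.\<close>
      have pos: "1 \<le> rk (A \<union> \<Union> (set_mset N) \<union> S)" if N: "N \<subseteq># M" for N
      proof -
        have "rk S \<le> rk (A \<union> \<Union> (set_mset N) \<union> S)"
          using Union_mset_subset[OF M N] S A by (intro polymatroid_mono[OF add.prems(2)]) auto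
        then show ?thesis using * by simp
      qed
      have "k \<le> Q A \<longleftrightarrow> (\<forall>N. N \<subseteq># M \<longrightarrow> k + size N \<le> rk (A \<union> \<Union> (set_mset N))
          \<and> Suc (k + size N) \<le> rk (A \<union> \<Union> (set_mset N) \<union> S))"
        unfolding Q(3)[OF A] trunc_def using pos by fastforce
      also have "\<dots> \<longleftrightarrow> (\<forall>N. N \<subseteq># add_mset S M \<longrightarrow> k + size N \<le> rk (A \<union> \<Union> (set_mset N)))"
        unfolding subseteq_add_mset_cases by (auto simp: Un_ac)
      finally show "k \<le> Q A \<longleftrightarrow> \<dots>" .
    qed
  qed
qed

lemma hr_weight_not_hr:
  "\<not> hr rk M \<Longrightarrow> hr_weight m rk (M + N) = 0"
  unfolding hr_weight_def using hr_subset[of rk "M + N" M] by auto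

section \<open>The degree functional of a polymatroid\<close>

type_synonym hpoly = "nat set multiset \<Rightarrow>\<^sub>0 int"

definition hmon :: "nat set multiset \<Rightarrow> hpoly" where
  "hmon M = Poly_Mapping.single M 1"

text \<open>The value 0 at the empty set matches the empty sum that defines h at the empty set, and
  \<open>sum_xpoly\<close> relies on it. It agrees with the functional, which vanishes on every
  monomial with an empty factor.\<close>

definition hvar :: "nat set \<Rightarrow> hpoly" where
  "hvar S = (if S = {} then 0 else hmon {#S#})"

text \<open>Solving $h_S = \sum_{T \not\supseteq S} x_T$ for $x_F$ by Moebius inversion.\<close>

definition xpoly :: "nat \<Rightarrow> nat set \<Rightarrow> hpoly" where
  "xpoly m F = - (\<Sum>S | F \<subseteq> S \<and> S \<subseteq> {1..m}. (-1) ^ (card F + card S) * hvar S)"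

definition hdeg :: "nat \<Rightarrow> (nat set \<Rightarrow> nat) \<Rightarrow> hpoly \<Rightarrow> int" where
  "hdeg m rk = lin (hr_weight m rk)"

lemma hmon_mult: "hmon M * hmon N = hmon (M + N)"
  by (simp add: hmon_def mult_single)

lemma hmon_empty: "hmon {#} = 1"
  by (simp add: hmon_def flip: zero_multiset_def)

lemma hdeg_hmon [simp]: "hdeg m rk (hmon M) = hr_weight m rk M"
  by (simp add: hdeg_def hmon_def)

lemma hdeg_mult_eqI:
  "(\<And>M. hdeg m rk (f * hmon M) = hdeg m' rk' (g * hmon M)) \<Longrightarrow> hdeg m rk (f * h) = hdeg m' rk' (g * h)"
  unfolding hdeg_def hmon_def by (rule lin_mult_eqI)

lemma hdeg_mult_zeroI:
  "(\<And>M. hdeg m rk (f * hmon M) = 0) \<Longrightarrow> hdeg m rk (f * h) = 0"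
  unfolding hdeg_def hmon_def by (rule lin_mult_zeroI)

lemma hdeg_hvar_mult:
  assumes "polymatroid m a rk" "S \<subseteq> {1..m}"
  shows "hdeg m rk (hvar S * f) = (if 1 \<le> rk S then hdeg m (trunc rk S) f else 0)"
proof -
  have *: "hdeg m rk (hvar S * hmon M) = hr_weight m rk (add_mset S M)" for M
    using hr_weight_empty_mem[OF assms(1)] by (auto simp: hvar_def hmon_mult) (simp add: hdeg_def)
  show ?thesis
  proof (cases "1 \<le> rk S")
    case True
    have "hdeg m rk (hvar S * f) = hdeg m (trunc rk S) (1 * f)"
      by (rule hdeg_mult_eqI) (use True in \<open>simp add: * hr_weight_add_mset[OF assms]\<close>)
    then show ?thesis using True by simp
  next
    case False
    have "hdeg m rk (hvar S * f) = 0"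
      by (rule hdeg_mult_zeroI) (simp only: * hr_weight_add_mset[OF assms] False if_False)
    then show ?thesis using False by simp
  qed
qed

lemma hdeg_hvar_hmon:
  assumes "polymatroid m a rk" "S \<subseteq> {1..m}"
  shows "hdeg m rk (hvar S * hmon M) = hr_weight m rk (add_mset S M)"
  by (simp add: hdeg_hvar_mult[OF assms] hr_weight_add_mset[OF assms])

lemma hdeg_hmon_mult:
  assumes "\<And>N. hr_weight m rk (M + N) = hr_weight m Q N"
  shows "hdeg m rk (hmon M * f) = hdeg m Q f"
  using hdeg_mult_eqI[of m rk "hmon M" m Q 1 f] by (simp add: hmon_mult assms)

lemma hdeg_not_hr: "\<not> hr rk M \<Longrightarrow> hdeg m rk (hmon M * f) = 0"
  by (rule hdeg_mult_zeroI) (simp add: hmon_mult hr_weight_not_hr)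

lemma hdeg_not_subset: "\<not> (\<forall>S\<in>#M. S \<subseteq> {1..m}) \<Longrightarrow> hdeg m rk (hmon M * f) = 0"
  by (rule hdeg_mult_zeroI) (auto simp: hmon_mult hr_weight_def)

lemma hdeg_xpoly_mult:
  "hdeg m rk (xpoly m F * f) =
     - (\<Sum>S | F \<subseteq> S \<and> S \<subseteq> {1..m}. (-1) ^ (card F + card S) * hdeg m rk (hvar S * f))"
  by (simp add: xpoly_def hdeg_def lin_uminus lin_sum sum_distrib_right mult.assoc lin_neg_one_power)

section \<open>Vanishing for non-flats, incomparable pairs and full fibres\<close>

text \<open>\<open>xpoly m F\<close> is an alternating sum over the interval from F to the ground
  set, so invariance under toggling a single e outside F already forces 0. The vanishing results
  below differ only in the choice of e and the reason for the invariance.\<close>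

lemma hdeg_xpoly_cancel:
  assumes "polymatroid m a rk" "e \<in> {1..m}" "e \<notin> F"
    and "\<And>S. F \<subseteq> S \<Longrightarrow> S \<subseteq> {1..m} \<Longrightarrow> e \<notin> S \<Longrightarrow>
      hr_weight m rk (add_mset (insert e S) M) = hr_weight m rk (add_mset S M)"
  shows "hdeg m rk (xpoly m F * hmon M) = 0"
proof -
  have "(\<Sum>S | F \<subseteq> S \<and> S \<subseteq> {1..m}. (-1) ^ (card F + card S) * hdeg m rk (hvar S * hmon M)) = 0"
  proof (rule sum_cancel_insert)
    fix S assume "F \<subseteq> S" "S \<subseteq> {1..m}" "e \<notin> S"
    then show "hdeg m rk (hvar (insert e S) * hmon M) = hdeg m rk (hvar S * hmon M)"
      using assms(2) assms(4)[of S]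
      by (simp only: hdeg_hvar_hmon[OF assms(1)] insert_subset simp_thms)
  qed (use assms in auto)
  then show ?thesis by (simp add: hdeg_xpoly_mult)
qed

text \<open>Take e outside F in the closure of F. It lies in the closure of each set S containing F,
  so inserting it into S changes no rank in the Hall--Rado condition.\<close>

lemma hdeg_nonflat:
  assumes P: "polymatroid m a rk" and F: "F \<subseteq> {1..m}" "\<not> is_flat m rk F"
  shows "hdeg m rk (xpoly m F * f) = 0"
proof (rule hdeg_mult_zeroI)
  fix M
  obtain e where e: "e \<in> {1..m}" "e \<notin> F" "rk (insert e F) \<le> rk F"
    using F by (auto simp: is_flat_def not_less)
  have eq: "rk (insert e F) = rk F"
  proof (rule antisym[OF e(3)])
    show "rk F \<le> rk (insert e F)"
      by (rule polymatroid_mono[OF P]) (use e F in auto)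
  qed
  show "hdeg m rk (xpoly m F * hmon M) = 0"
  proof (rule hdeg_xpoly_cancel[OF P e(1,2)])
    fix S assume S: "F \<subseteq> S" "S \<subseteq> {1..m}" "e \<notin> S"
    have *: "rk (insert e (S \<union> \<Union> (set_mset N))) = rk (S \<union> \<Union> (set_mset N))"
      if "\<forall>S\<in>#M. S \<subseteq> {1..m}" "N \<subseteq># M" for N
      by (rule polymatroid_closure_mono[OF P _ _ e(1) eq]) (use S Union_mset_subset[OF that] in blast)+
    have "hr rk (add_mset (insert e S) M) \<longleftrightarrow> hr rk (add_mset S M)" if "\<forall>S\<in>#M. S \<subseteq> {1..m}"
      using *[OF that] by (simp add: hr_add_mset)
    then show "hr_weight m rk (add_mset (insert e S) M) = hr_weight m rk (add_mset S M)"
      using S(2) e(1) unfolding hr_weight_def by (intro if_cong) auto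
  qed
qed

lemma hr_empty: "hr rk {#}"
  by (simp add: hr_def)

text \<open>Truncating by M leaves only two factors. If F and G are flats of Q, then Q F and Q G are
  less than Q of the union, which is at most their sum. Hence both are at least 1 and the union has
  rank at least 2, so any S over F and T over G satisfy Hall--Rado together. The weight is therefore
  constant in S and the alternating sum cancels.\<close>

lemma hdeg_incomparable:
  assumes P: "polymatroid m a rk" and F: "F \<subset> {1..m}" "G \<subset> {1..m}"
    and inc: "\<not> F \<subseteq> G" "\<not> G \<subseteq> F"
  shows "hdeg m rk (xpoly m F * xpoly m G * f) = 0"
proof (rule hdeg_mult_zeroI)
  fix M
  have comm: "xpoly m F * xpoly m G * hmon M = hmon M * (xpoly m F * xpoly m G)"
    by (simp add: mult_ac)
  show "hdeg m rk (xpoly m F * xpoly m G * hmon M) = 0"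
  proof (cases "(\<forall>S\<in>#M. S \<subseteq> {1..m}) \<and> hr rk M")
    case False
    then show ?thesis unfolding comm using hdeg_not_hr hdeg_not_subset by blast
  next
    case True
    obtain Q where Q: "polymatroid m a Q" "\<And>N. hr_weight m rk (M + N) = hr_weight m Q N"
      by (rule truncation_exists[OF P, of M]) (use True in blast)+
    have "hdeg m Q (xpoly m F * xpoly m G) = 0"
    proof (cases "is_flat m Q F \<and> is_flat m Q G")
      case False
      then show ?thesis
        using hdeg_nonflat[OF Q(1), of F "xpoly m G"] hdeg_nonflat[OF Q(1), of G "xpoly m F"] F
        by (auto simp: mult.commute)
    next
      case flats: True
      note mono = polymatroid_mono[OF Q(1)]
      have FG: "Q F < Q (F \<union> G)" "Q G < Q (F \<union> G)"
        using flat_rank_less[OF Q(1), of F G] flat_rank_less[OF Q(1), of G F] flats F inc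
        by (auto simp: Un_commute)
      have sub: "Q (F \<union> G) \<le> Q F + Q G"
        using polymatroid_submod[OF Q(1), of F G] F by auto
      obtain e where e: "e \<in> {1..m}" "e \<notin> F" using F(1) by blast
      have "hdeg m Q (hvar T * xpoly m F) = 0" if T: "G \<subseteq> T" "T \<subseteq> {1..m}" for T
      proof -
        have "T \<noteq> {}" using T inc by auto
        moreover have "hdeg m Q (xpoly m F * hmon {#T#}) = 0"
        proof (rule hdeg_xpoly_cancel[OF Q(1) e])
          have hr: "hr Q {#S, T#}" if S: "F \<subseteq> S" "S \<subseteq> {1..m}" for S
          proof -
            have "Q F \<le> Q S" "Q G \<le> Q T" "Q (F \<union> G) \<le> Q (S \<union> T)"
              using S T by (intro mono; blast)+
            then show ?thesis
              using FG sub by (auto simp: hr_add_mset hr_empty subseteq_add_mset_cases)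
          qed
          fix S assume "F \<subseteq> S" "S \<subseteq> {1..m}" "e \<notin> S"
          then show "hr_weight m Q {#insert e S, T#} = hr_weight m Q {#S, T#}"
            using hr[of S] hr[of "insert e S"] e by (auto simp: hr_weight_def)
        qed
        ultimately show ?thesis by (simp add: hvar_def mult.commute[of "hmon _"])
      qed
      then have "hdeg m Q (xpoly m G * xpoly m F) = 0"
        by (simp add: hdeg_xpoly_mult[of m Q G])
      then show ?thesis by (simp add: mult.commute)
    qed
    then show ?thesis unfolding comm hdeg_hmon_mult[OF Q(2)] .
  qed
qed

text \<open>Toggling i is invisible to the Hall--Rado condition. If N contains a copy of {i}, the
  union contains i anyway. If not, apply the bound to N with all \<open>a i\<close> copies added:
  deleting i from S costs at most \<open>rk {i} \<le> a i\<close>, which the added copies pay for.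
  When \<open>a i = 0\<close> there are no copies and i is a loop.\<close>

lemma hdeg_full_fibre:
  assumes P: "polymatroid m a rk" and i: "i \<in> {1..m}" "i \<notin> F"
  shows "hdeg m rk (xpoly m F * hmon (replicate_mset (a i) {i}) * f) = 0"
proof (rule hdeg_mult_zeroI)
  fix M
  let ?R = "replicate_mset (a i) {i}"
  have "hdeg m rk (xpoly m F * hmon (?R + M)) = 0"
  proof (rule hdeg_xpoly_cancel[OF P i])
    fix S assume S: "F \<subseteq> S" "S \<subseteq> {1..m}" "i \<notin> S"
    have "hr rk (add_mset S (?R + M))"
      if M: "\<forall>S\<in>#M. S \<subseteq> {1..m}" and h: "hr rk (add_mset (insert i S) (?R + M))"
    proof -
      have "Suc (size N) \<le> rk (S \<union> \<Union> (set_mset N))" if N: "N \<subseteq># ?R + M" for N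
      proof (cases "{i} \<in># N")
        case True
        then have "S \<union> \<Union> (set_mset N) = insert i S \<union> \<Union> (set_mset N)" by auto
        then show ?thesis using h N by (auto simp: hr_add_mset)
      next
        case False
        have NM: "N \<subseteq># M"
          unfolding subseteq_mset_def
        proof
          fix x show "count N x \<le> count M x"
            using mset_subset_eq_count[OF N, of x] False by (cases "x = {i}") (auto simp: not_in_iff)
        qed
        have sub: "\<Union> (set_mset N) \<subseteq> {1..m}" by (rule Union_mset_subset[OF M NM])
        have "?R + N \<subseteq># ?R + M" using NM by simp
        then have "Suc (size (?R + N)) \<le> rk (insert i S \<union> \<Union> (set_mset (?R + N)))"
          using h unfolding hr_add_mset by blast
        moreover have "insert i S \<union> \<Union> (set_mset (?R + N)) = (S \<union> \<Union> (set_mset N)) \<union> {i}"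
          by auto
        ultimately have "Suc (a i + size N) \<le> rk ((S \<union> \<Union> (set_mset N)) \<union> {i})" by simp
        also have "\<dots> \<le> rk (S \<union> \<Union> (set_mset N)) + rk {i}"
          using polymatroid_submod[OF P, of "S \<union> \<Union> (set_mset N)" "{i}"] S sub i by auto
        also have "rk {i} \<le> a i" by (rule polymatroid_singleton[OF P i(1)])
        finally show ?thesis by simp
      qed
      then show ?thesis using h by (simp add: hr_add_mset)
    qed
    moreover have "hr rk (add_mset (insert i S) (?R + M))"
      if M: "\<forall>S\<in>#M. S \<subseteq> {1..m}" and h: "hr rk (add_mset S (?R + M))"
    proof -
      have "Suc (size N) \<le> rk (insert i S \<union> \<Union> (set_mset N))" if N: "N \<subseteq># ?R + M" for N
      proof -
        have "\<forall>S\<in>#?R + M. S \<subseteq> {1..m}" using M i by auto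
        then have "\<Union> (set_mset N) \<subseteq> {1..m}" using Union_mset_subset N by blast
        then have "rk (S \<union> \<Union> (set_mset N)) \<le> rk (insert i S \<union> \<Union> (set_mset N))"
          using S i by (intro polymatroid_mono[OF P]) auto
        moreover have "Suc (size N) \<le> rk (S \<union> \<Union> (set_mset N))"
          using h N by (auto simp: hr_add_mset)
        ultimately show ?thesis by simp
      qed
      then show ?thesis using h by (simp add: hr_add_mset)
    qed
    ultimately show "hr_weight m rk (add_mset (insert i S) (?R + M)) = hr_weight m rk (add_mset S (?R + M))"
      using S i by (auto simp: hr_weight_def)
  qed
  then show "hdeg m rk (xpoly m F * hmon ?R * hmon M) = 0"
    by (simp add: mult.assoc hmon_mult)
qed

section \<open>Chains of flats\<close>

lemma finite_chain_has_least:
  assumes "finite C" "C \<noteq> {}" "\<forall>F\<in>C. \<forall>G\<in>C. F \<subseteq> G \<or> G \<subseteq> (F::'a set)"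
  obtains F where "F \<in> C" "\<And>G. G \<in> C \<Longrightarrow> F \<subseteq> G"
proof -
  obtain F where F: "F \<in> C" "\<forall>G\<in>C. G \<subseteq> F \<longrightarrow> F = G"
    using finite_has_minimal[OF assms(1,2)] by auto
  show ?thesis by (rule that[OF F(1)]) (use F assms(3) in blast)
qed

lemma finite_chain_has_greatest:
  assumes "finite C" "C \<noteq> {}" "\<forall>F\<in>C. \<forall>G\<in>C. F \<subseteq> G \<or> G \<subseteq> (F::'a set)"
  obtains F where "F \<in> C" "\<And>G. G \<in> C \<Longrightarrow> G \<subseteq> F"
proof -
  obtain F where F: "F \<in> C" "\<forall>G\<in>C. F \<subseteq> G \<longrightarrow> F = G"
    using finite_has_maximal[OF assms(1,2)] by auto
  show ?thesis by (rule that[OF F(1)]) (use F assms(3) in blast)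
qed

lemma finite_proper_subsets: "\<forall>F\<in>C. F \<subset> {1..m::nat} \<Longrightarrow> finite C"
  by (rule finite_subset[of _ "Pow {1..m}"]) auto

lemma inj_on_flat_chain:
  assumes P: "polymatroid m a Q" and C: "\<forall>F\<in>C. F \<subset> {1..m}" "\<forall>F\<in>C. \<forall>G\<in>C. F \<subseteq> G \<or> G \<subseteq> F"
    and flats: "\<forall>F\<in>C. is_flat m Q F"
  shows "inj_on Q (insert {1..m} C)"
proof (rule inj_onI, rule ccontr)
  fix F G assume FG: "F \<in> insert {1..m} C" "G \<in> insert {1..m} C" "Q F = Q G" "F \<noteq> G"
  have "F \<subset> G \<or> G \<subset> F" using FG C by blast
  then show False
  proof
    assume "F \<subset> G"
    moreover have "is_flat m Q F" "G \<subseteq> {1..m}" using \<open>F \<subset> G\<close> FG C flats by auto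
    ultimately show False using flat_psubset_rank_less[OF P _ \<open>F \<subset> G\<close>] FG(3) by simp
  next
    assume "G \<subset> F"
    moreover have "is_flat m Q G" "F \<subseteq> {1..m}" using \<open>G \<subset> F\<close> FG C flats by auto
    ultimately show False using flat_psubset_rank_less[OF P _ \<open>G \<subset> F\<close>] FG(3) by simp
  qed
qed

text \<open>Induction on the rank by expanding x at the least member F1. A complete chain of flats
  has ranks 0, 1, ..., so F1 has rank 0 and the next member G has rank 1. Truncating along S keeps
  the other members flat exactly when S is inside G. The alternating sum from F1 to G would be 0,
  but its term S = F1 is missing because F1 has rank 0; with the sign in \<open>xpoly\<close> this
  leaves 1.\<close>

lemma hdeg_chain:
  assumes "polymatroid m a Q" "\<forall>F\<in>C. F \<subset> {1..m}" "\<forall>F\<in>C. \<forall>G\<in>C. F \<subseteq> G \<or> G \<subseteq> F"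
    and "card C = Q {1..m}"
  shows "hdeg m Q (\<Prod>F\<in>C. xpoly m F) = (if \<forall>F\<in>C. is_flat m Q F then 1 else 0)"
  using assms
proof (induction "card C" arbitrary: C Q)
  case 0
  have "C = {}" using 0 finite_proper_subsets[OF 0(3)] by simp
  have "hdeg m Q 1 = hr_weight m Q {#}" by (simp flip: hmon_empty)
  then show ?case using 0 \<open>C = {}\<close> by (simp add: hr_weight_def hr_empty)
next
  case (Suc k)
  note P = Suc.prems(1) and proper = Suc.prems(2) and chain = Suc.prems(3)
  note mono = polymatroid_mono[OF P]
  have fin: "finite C" by (rule finite_proper_subsets[OF proper])
  show ?case
  proof (cases "\<forall>F\<in>C. is_flat m Q F")
    case False
    then obtain F where F: "F \<in> C" "\<not> is_flat m Q F" by auto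
    then have "(\<Prod>F\<in>C. xpoly m F) = xpoly m F * (\<Prod>F\<in>C - {F}. xpoly m F)"
      using fin by (simp add: prod.remove)
    then show ?thesis using False hdeg_nonflat[OF P _ F(2)] F proper by auto
  next
    case True
    have "C \<noteq> {}" using Suc.hyps(2) by auto
    then obtain F1 where F1: "F1 \<in> C" "\<And>G. G \<in> C \<Longrightarrow> F1 \<subseteq> G"
      using finite_chain_has_least[OF fin _ chain] by blast
    define C' where "C' = C - {F1}"
    have C': "card C' = k" "finite C'" "\<forall>F\<in>C'. F \<subset> {1..m}"
      "\<forall>F\<in>C'. \<forall>G\<in>C'. F \<subseteq> G \<or> G \<subseteq> F" "\<And>F. F \<in> C' \<Longrightarrow> F1 \<subset> F" "C = insert F1 C'" "F1 \<notin> C'"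
      using F1 Suc.hyps(2) fin proper chain by (auto simp: C'_def)
    \<comment> \<open>Inserting the ground set provides a successor of F1 even when C has only one
      member.\<close>
    obtain G where G: "G \<in> insert {1..m} C'" "\<And>F. F \<in> insert {1..m} C' \<Longrightarrow> G \<subseteq> F"
    proof (rule finite_chain_has_least[of "insert {1..m} C'"])
      show "\<forall>F\<in>insert {1..m} C'. \<forall>G\<in>insert {1..m} C'. F \<subseteq> G \<or> G \<subseteq> F"
        using C' by blast
    qed (use C' in auto)
    have F1G: "F1 \<subset> G" using G(1) C'(5) proper F1 by auto
    have GE: "G \<subseteq> {1..m}" using G by auto
    have F1E: "F1 \<subset> {1..m}" using F1 proper by auto
    have inj: "inj_on Q (insert {1..m} C)"
      by (rule inj_on_flat_chain[OF P proper chain True])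
    have "{1..m} \<notin> C" using proper by blast
    \<comment> \<open>Ranks of flats in a chain are distinct; k + 2 of them in 0, ..., k + 1 leave
      no gap.\<close>
    then have "card (Q ` insert {1..m} C) = k + 2"
      using inj fin Suc.hyps(2) by (simp add: card_image)
    moreover have "Q ` insert {1..m} C \<subseteq> {..k+1}"
      using Suc.hyps(2) Suc.prems(4) mono proper by fastforce
    ultimately have img: "Q ` insert {1..m} C = {..k+1}"
      by (intro card_subset_eq) auto
    have QF1: "Q F1 = 0"
    proof -
      have "0 \<in> Q ` insert {1..m} C" unfolding img by simp
      then obtain X where X: "X \<in> insert {1..m} C" "Q X = 0" by (metis imageE)
      then have "F1 \<subseteq> X" "X \<subseteq> {1..m}" using F1 F1E proper by auto
      from mono[OF this] show ?thesis using X by simp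
    qed
    have Qpos: "1 \<le> Q X" if "F1 \<subset> X" "X \<subseteq> {1..m}" for X
      using flat_psubset_rank_less[OF P _ that] True F1(1) by (simp add: Suc_le_eq)
    have QG: "Q G = 1"
    proof -
      have "1 \<in> Q ` insert {1..m} C" unfolding img by simp
      then obtain X where X: "X \<in> insert {1..m} C" "Q X = 1" by (metis imageE)
      then have "X \<in> insert {1..m} C'" using QF1 C' by auto
      then have "G \<subseteq> X" "X \<subseteq> {1..m}" using G X proper by auto
      from mono[OF this] have "Q G \<le> 1" using X by simp
      then show ?thesis using Qpos[OF F1G GE] by simp
    qed
    \<comment> \<open>The second indicator corrects the value at S = F1, where the first would give
      1 although h at a set of rank 0 contributes nothing.\<close>
    have step: "hdeg m Q (hvar S * (\<Prod>F\<in>C'. xpoly m F)) = (if S \<subseteq> G then 1 else 0) - (if S = F1 then 1 else 0)"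
      if S: "F1 \<subseteq> S" "S \<subseteq> {1..m}" for S
    proof (cases "S = F1")
      case True
      then show ?thesis using F1G QF1 hdeg_hvar_mult[OF P S(2)] by auto
    next
      case False
      then have F1S: "F1 \<subset> S" using S by auto
      have QS: "1 \<le> Q S" by (rule Qpos[OF F1S S(2)])
      note PT = polymatroid_trunc[OF P S(2) QS]
      have "hdeg m Q (hvar S * (\<Prod>F\<in>C'. xpoly m F)) = hdeg m (trunc Q S) (\<Prod>F\<in>C'. xpoly m F)"
        using QS by (simp add: hdeg_hvar_mult[OF P S(2)])
      also have "\<dots> = (if \<forall>F\<in>C'. is_flat m (trunc Q S) F then 1 else 0)"
      proof (rule Suc.hyps(1)[OF _ PT C'(3,4)])
        show "card C' = trunc Q S {1..m}"
          using trunc_top[OF P S(2)] C'(1) Suc.hyps(2) Suc.prems(4) by simp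
      qed (use C' in simp)
      also have "(\<forall>F\<in>C'. is_flat m (trunc Q S) F) \<longleftrightarrow> S \<subseteq> G"
      proof
        assume SG: "S \<subseteq> G"
        show "\<forall>F\<in>C'. is_flat m (trunc Q S) F"
        proof
          fix F assume F: "F \<in> C'"
          then have SF: "S \<subseteq> F" using SG G(2) by blast
          have FE: "F \<subseteq> {1..m}" and flat: "is_flat m Q F" using F C'(3,6) True \<open>\<forall>F\<in>C. is_flat m Q F\<close> by auto
          have "1 \<le> Q F" using Qpos[OF C'(5)[OF F] FE] .
          then show "is_flat m (trunc Q S) F"
            using flat SF by (auto simp: is_flat_def trunc_def Un_absorb2 subset_insertI2 intro!: diff_less_mono)
        qed
      next
        assume fl: "\<forall>F\<in>C'. is_flat m (trunc Q S) F"
        show "S \<subseteq> G"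
        proof (rule ccontr)
          \<comment> \<open>If S leaves G, truncation does not lower the rank 1 of G, so k + 1
            flats, the ground set included, would need distinct ranks among 1, ..., k.\<close>
          assume SG: "\<not> S \<subseteq> G"
          then have GC: "G \<in> C'" using G(1) S by auto
          have "Q G < Q (G \<union> S)"
            using flat_rank_less[OF P _ S(2) SG] GC C'(6) \<open>\<forall>F\<in>C. is_flat m Q F\<close> by auto
          then have tG: "trunc Q S G = 1" using QG by (simp add: trunc_def)
          have "inj_on (trunc Q S) (insert {1..m} C')"
            by (rule inj_on_flat_chain[OF PT C'(3,4) fl])
          moreover have "trunc Q S ` insert {1..m} C' \<subseteq> {1..k}"
          proof (rule image_subsetI)
            fix X assume X: "X \<in> insert {1..m} C'"
            then have "G \<subseteq> X" "X \<subseteq> {1..m}" using G(2) C'(3) by auto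
            then have "trunc Q S G \<le> trunc Q S X" "trunc Q S X \<le> trunc Q S {1..m}"
              by (auto intro!: polymatroid_mono[OF PT])
            then show "trunc Q S X \<in> {1..k}"
              using tG trunc_top[OF P S(2)] Suc.hyps(2) Suc.prems(4) by simp
          qed
          ultimately have "card (insert {1..m} C') \<le> card {1..k}"
            by (intro card_inj_on_le) auto
          moreover have "{1..m} \<notin> C'" using C'(3) by blast
          ultimately show False using C'(1,2) by simp
        qed
      qed
      finally show ?thesis using False by simp
    qed
    have prod: "(\<Prod>F\<in>C. xpoly m F) = xpoly m F1 * (\<Prod>F\<in>C'. xpoly m F)"
      using C' by simp
    have "hdeg m Q (\<Prod>F\<in>C. xpoly m F) = - (\<Sum>S | F1 \<subseteq> S \<and> S \<subseteq> {1..m}.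
        (-1) ^ (card F1 + card S) * ((if S \<subseteq> G then 1 else 0) - (if S = F1 then 1 else 0)))"
      unfolding prod hdeg_xpoly_mult by (intro arg_cong[of _ _ uminus] sum.cong) (auto simp: step)
    also have "\<dots> = - ((\<Sum>S | F1 \<subseteq> S \<and> S \<subseteq> {1..m}. if S \<subseteq> G then (-1) ^ (card F1 + card S) else 0)
        - (\<Sum>S | F1 \<subseteq> S \<and> S \<subseteq> {1..m}. if S = F1 then (-1) ^ (card F1 + card S) else 0))"
      unfolding sum_subtractf[symmetric] by (intro arg_cong[of _ _ uminus] sum.cong) auto
    also have "(\<Sum>S | F1 \<subseteq> S \<and> S \<subseteq> {1..m}. if S = F1 then (-1) ^ (card F1 + card S) else 0) = (1::int)"
      using F1E by (simp add: sum.delta power_add flip: power_mult_distrib)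
    also have "(\<Sum>S | F1 \<subseteq> S \<and> S \<subseteq> {1..m}. if S \<subseteq> G then (-1) ^ (card F1 + card S) else (0::int))
       = (\<Sum>S | F1 \<subseteq> S \<and> S \<subseteq> G. (-1) ^ (card F1 + card S))"
      by (rule sum.mono_neutral_cong_right) (use GE in auto)
    also have "\<dots> = 0"
      using F1G finite_subset[OF GE] by (subst sum_alternating_interval) auto
    finally show ?thesis using True by simp
  qed
qed

section \<open>Values on cone monomials\<close>

text \<open>The bridge between submultisets and index sets when f may repeat values: N lifts to a
  submultiset of \<open>mset_set I\<close>, whose multiplicities are at most 1, so the lift is
  itself a set.\<close>

lemma subseteq_mset_set_image:
  assumes "finite I"
  shows "N \<subseteq># image_mset f (mset_set I) \<longleftrightarrow> (\<exists>T\<subseteq>I. N = image_mset f (mset_set T))"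
proof
  assume "N \<subseteq># image_mset f (mset_set I)"
  then obtain K where "image_mset f (mset_set I) = N + K" by (auto simp: mset_subset_eq_exists_conv)
  then obtain N' K' where N': "mset_set I = N' + K'" "N = image_mset f N'"
    using image_mset_eq_plusD by metis
  then have sub: "N' \<subseteq># mset_set I" by simp
  have "N' = mset_set (set_mset N')"
  proof (rule multiset_eqI)
    fix x
    have "count N' x \<le> count (mset_set I) x" using sub by (rule mset_subset_eq_count)
    also have "\<dots> \<le> 1" using assms by (cases "x \<in> I") auto
    finally show "count N' x = count (mset_set (set_mset N')) x"
      by (cases "x \<in># N'") (auto simp: not_in_iff le_Suc_eq count_greater_zero_iff[symmetric] simp del: count_greater_zero_iff)
  qed
  moreover have "set_mset N' \<subseteq> I" using set_mset_mono[OF sub] assms by simp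
  ultimately show "\<exists>T\<subseteq>I. N = image_mset f (mset_set T)" using N'(2) by metis
next
  assume "\<exists>T\<subseteq>I. N = image_mset f (mset_set T)"
  then show "N \<subseteq># image_mset f (mset_set I)"
    using assms by (auto intro!: image_mset_subseteq_mono subset_imp_msubset_mset_set)
qed

lemma finite_Etil: "finite (Etil m a)"
proof -
  have "Etil m a = (SIGMA i:{1..m}. {..<a i})" by (auto simp: Etil_def)
  then show ?thesis by simp
qed

lemma card_Etil: "card (Etil m a) = (\<Sum>i\<in>{1..m}. a i)"
proof -
  have "Etil m a = (SIGMA i:{1..m}. {..<a i})" by (auto simp: Etil_def)
  then show ?thesis by simp
qed

lemma fst_Etil: "I \<subseteq> Etil m a \<Longrightarrow> fst ` I \<subseteq> {1..m}"
  by (auto simp: Etil_def)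

lemma card_preim:
  assumes "A \<subseteq> {1..m}"
  shows "card (preim m a A) = (\<Sum>i\<in>A. a i)"
proof -
  have "preim m a A = (SIGMA i:A. {..<a i})" using assms by (auto simp: preim_def Etil_def)
  then show ?thesis using finite_subset[OF assms] by simp
qed

text \<open>The linear relations identify the ray e_j with h of the singleton {fst j}; points of the
  same fibre give repeated singletons, hence a multiset.\<close>

definition point_mset :: "(nat \<times> nat) set \<Rightarrow> nat set multiset" where
  "point_mset I = image_mset (\<lambda>j. {fst j}) (mset_set I)"

lemma size_point_mset [simp]: "size (point_mset I) = card I"
  by (simp add: point_mset_def)

lemma Union_point_mset [simp]: "finite I \<Longrightarrow> \<Union> (set_mset (point_mset I)) = fst ` I"
  by (auto simp: point_mset_def)

lemma point_mset_subset: "I \<subseteq> Etil m a \<Longrightarrow> \<forall>S\<in>#point_mset I. S \<subseteq> {1..m}"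
  using finite_subset[OF _ finite_Etil] by (force simp: point_mset_def Etil_def)

lemma all_subseteq_point_mset:
  assumes "finite I"
  shows "(\<forall>N. N \<subseteq># point_mset I \<longrightarrow> P (size N) (\<Union> (set_mset N))) \<longleftrightarrow> (\<forall>T\<subseteq>I. P (card T) (fst ` T))"
proof -
  have "(\<forall>N. N \<subseteq># point_mset I \<longrightarrow> P (size N) (\<Union> (set_mset N)))
     \<longleftrightarrow> (\<forall>T\<subseteq>I. P (size (point_mset T)) (\<Union> (set_mset (point_mset T))))"
    using subseteq_mset_set_image[OF assms] unfolding point_mset_def by metis
  also have "\<dots> \<longleftrightarrow> (\<forall>T\<subseteq>I. P (card T) (fst ` T))"
    using finite_subset[OF _ assms] by (metis Union_point_mset size_point_mset)
  finally show ?thesis .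
qed

lemma hr_point_mset: "finite I \<Longrightarrow> hr rk (point_mset I) \<longleftrightarrow> (\<forall>T\<subseteq>I. card T \<le> rk (fst ` T))"
  using all_subseteq_point_mset[of I "\<lambda>n A. n \<le> rk A"] by (simp add: hr_def)

text \<open>This is where condition (2) of the augmented Bergman fan comes from: it describes the
  flats of the truncation by the points of I. By \<open>thr\<close>, Q A is the minimum over T in I
  of the rank of A with the image of T, minus \<open>card T\<close>, and both directions analyse a T
  attaining it.\<close>

lemma flat_truncation_iff:
  assumes P: "polymatroid m a rk" and Q: "polymatroid m a Q" and I: "I \<subseteq> Etil m a"
    and thr: "\<And>A k. A \<subseteq> {1..m} \<Longrightarrow> k \<le> Q A \<longleftrightarrow> (\<forall>T\<subseteq>I. k + card T \<le> rk (A \<union> fst ` T))"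
    and F: "F \<subseteq> {1..m}"
  shows "is_flat m Q F \<longleftrightarrow> is_flat m rk F \<and>
    (\<forall>T. T \<subseteq> I - preim m a F \<longrightarrow> T \<noteq> {} \<longrightarrow> rk F + card T < rk (F \<union> fst ` T))"
proof -
  have fin: "finite T" if "T \<subseteq> I" for T
    using that I finite_subset[OF _ finite_Etil] by blast
  have fstI: "fst ` T \<subseteq> {1..m}" if "T \<subseteq> I" for T
    using that I fst_Etil by blast
  have le: "Q A + card T \<le> rk (A \<union> fst ` T)" if "A \<subseteq> {1..m}" "T \<subseteq> I" for A T
    using thr[OF that(1), of "Q A"] that(2) by simp
  have attain: "\<exists>T\<subseteq>I. Q A + card T = rk (A \<union> fst ` T)" if A: "A \<subseteq> {1..m}" for A
  proof -
    have "\<not> Suc (Q A) \<le> Q A" by simp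
    then obtain T where "T \<subseteq> I" "\<not> Suc (Q A) + card T \<le> rk (A \<union> fst ` T)"
      using thr[OF A, of "Suc (Q A)"] by blast
    moreover have "Q A + card T \<le> rk (A \<union> fst ` T)" by (rule le) fact+
    ultimately show ?thesis by (intro exI[of _ T]) auto
  qed
  show ?thesis
  proof
    assume flat: "is_flat m Q F"
    have "is_flat m rk F"
    proof (rule ccontr)
      assume "\<not> is_flat m rk F"
      then obtain e where e: "e \<in> {1..m}" "e \<notin> F" "rk (insert e F) \<le> rk F"
        using F by (auto simp: is_flat_def not_less)
      have eq: "rk (insert e F) = rk F"
      proof (rule antisym[OF e(3)])
        show "rk F \<le> rk (insert e F)" by (rule polymatroid_mono[OF P]) (use e F in auto)
      qed
      obtain T where T: "T \<subseteq> I" "Q F + card T = rk (F \<union> fst ` T)" using attain[OF F] by blast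
      have "rk (insert e (F \<union> fst ` T)) = rk (F \<union> fst ` T)"
        by (rule polymatroid_closure_mono[OF P _ _ e(1) eq]) (use F fstI[OF T(1)] in auto)
      moreover have "Q (insert e F) + card T \<le> rk (insert e F \<union> fst ` T)"
        by (rule le) (use e F T in auto)
      ultimately have "Q (insert e F) \<le> Q F" using T by simp
      then show False using flat e(1,2) unfolding is_flat_def by (meson DiffI leD)
    qed
    moreover have "rk F + card T < rk (F \<union> fst ` T)" if T: "T \<subseteq> I - preim m a F" "T \<noteq> {}" for T
    proof (rule ccontr)
      assume small: "\<not> ?thesis"
      have TI: "T \<subseteq> I" using T by auto
      obtain T0 where T0: "T0 \<subseteq> I" "Q F + card T0 = rk (F \<union> fst ` T0)" using attain[OF F] by blast
      have out: "fst j \<notin> F" if "j \<in> T" for j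
        using that T I by (auto simp: preim_def)
      \<comment> \<open>Adding the image of a minimiser to F leaves its bound unchanged, so Q cannot
        grow; a flat must already contain that image.\<close>
      have in0: "fst ` T0 \<subseteq> F"
      proof (rule ccontr)
        assume "\<not> fst ` T0 \<subseteq> F"
        then have "Q F < Q (F \<union> fst ` T0)" using flat_rank_less[OF Q flat fstI[OF T0(1)]] by simp
        moreover have "Q (F \<union> fst ` T0) + card T0 \<le> rk (F \<union> fst ` T0 \<union> fst ` T0)"
          by (rule le) (use F T0 fstI[OF T0(1)] in auto)
        ultimately show False using T0 by (simp add: Un_assoc)
      qed
      then have disj: "T \<inter> T0 = {}" using out by blast
      have "Q (F \<union> fst ` T) + card (T \<union> T0) \<le> rk (F \<union> fst ` T \<union> fst ` (T \<union> T0))"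
        by (rule le) (use F TI T0 fstI[OF TI] in auto)
      also have "F \<union> fst ` T \<union> fst ` (T \<union> T0) = F \<union> fst ` T" using in0 by auto
      also have "rk \<dots> \<le> rk F + card T" using small by simp
      also have "rk F = Q F + card T0" using T0(2) in0 by (simp add: Un_absorb2)
      finally have "Q (F \<union> fst ` T) \<le> Q F"
        using card_Un_disjoint[OF fin[OF TI] fin[OF T0(1)] disj] by simp
      moreover have "\<not> fst ` T \<subseteq> F" using T(2) out by auto
      then have "Q F < Q (F \<union> fst ` T)" by (rule flat_rank_less[OF Q flat fstI[OF TI]])
      ultimately show False by simp
    qed
    ultimately show "is_flat m rk F \<and>
      (\<forall>T. T \<subseteq> I - preim m a F \<longrightarrow> T \<noteq> {} \<longrightarrow> rk F + card T < rk (F \<union> fst ` T))" by blast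
  next
    assume r: "is_flat m rk F \<and>
      (\<forall>T. T \<subseteq> I - preim m a F \<longrightarrow> T \<noteq> {} \<longrightarrow> rk F + card T < rk (F \<union> fst ` T))"
    have "Q F < Q (insert e F)" if e: "e \<in> {1..m}" "e \<notin> F" for e
    proof -
      have eF: "insert e F \<subseteq> {1..m}" using e F by auto
      obtain T where T: "T \<subseteq> I" "Q (insert e F) + card T = rk (insert e F \<union> fst ` T)"
        using attain[OF eF] by blast
      \<comment> \<open>The part of the minimiser over F is charged to Q F, the part off F to the
        strict inequality; if the latter part is empty, flatness for \<open>rk\<close> supplies the
        strictness.\<close>
      define T1 where "T1 = T \<inter> preim m a F"
      define T2 where "T2 = T - preim m a F"
      have T12: "T1 \<subseteq> I" "T2 \<subseteq> I" "card T = card T1 + card T2"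
        using T(1) fin[OF T(1)] card_Un_disjoint[of T1 T2] by (auto simp: T1_def T2_def Int_Diff_Un)
      have "fst ` T1 \<subseteq> F" by (auto simp: T1_def preim_def)
      then have q: "Q F + card T1 \<le> rk F" using le[OF F T12(1)] by (simp add: Un_absorb2)
      have "rk F + card T2 < rk (insert e F \<union> fst ` T)"
      proof (cases "T2 = {}")
        case True
        have "rk F < rk (insert e F)" using r e by (auto simp: is_flat_def)
        also have "\<dots> \<le> rk (insert e F \<union> fst ` T)"
          by (rule polymatroid_mono[OF P]) (use eF fstI[OF T(1)] in auto)
        finally show ?thesis using True by simp
      next
        case False
        have "rk F + card T2 < rk (F \<union> fst ` T2)"
          by (rule conjunct2[OF r, rule_format, OF _ False]) (use T(1) in \<open>auto simp: T2_def\<close>)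
        also have "\<dots> \<le> rk (insert e F \<union> fst ` T)"
          by (rule polymatroid_mono[OF P]) (use eF fstI[OF T(1)] in \<open>auto simp: T2_def\<close>)
        finally show ?thesis .
      qed
      then show ?thesis using q T T12(3) by simp
    qed
    then show "is_flat m Q F" using F by (auto simp: is_flat_def)
  qed
qed

text \<open>The points of I are absorbed into a truncation Q, whose rank is then the length of the
  chain, so \<open>hdeg_chain\<close> applies. Hall--Rado for the points is condition (1) of the
  fan.\<close>

lemma hdeg_cone:
  assumes P: "polymatroid m a rk" and I: "I \<subseteq> Etil m a"
    and C: "\<forall>F\<in>C. F \<subset> {1..m}" "\<forall>F\<in>C. \<forall>G\<in>C. F \<subseteq> G \<or> G \<subseteq> F"
    and card: "card I + card C = rk {1..m}"
  shows "hdeg m rk (hmon (point_mset I) * (\<Prod>F\<in>C. xpoly m F)) =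
    (if (\<forall>T\<subseteq>I. card T \<le> rk (fst ` T)) \<and> (\<forall>F\<in>C. is_flat m rk F \<and>
       (\<forall>T. T \<subseteq> I - preim m a F \<longrightarrow> T \<noteq> {} \<longrightarrow> rk F + card T < rk (F \<union> fst ` T))) then 1 else 0)"
proof -
  have fin: "finite I" using I finite_Etil finite_subset by blast
  show ?thesis
  proof (cases "\<forall>T\<subseteq>I. card T \<le> rk (fst ` T)")
    case False
    then have "\<not> hr rk (point_mset I)" by (simp add: hr_point_mset[OF fin])
    then have "hdeg m rk (hmon (point_mset I) * (\<Prod>F\<in>C. xpoly m F)) = 0" by (rule hdeg_not_hr)
    then show ?thesis by (subst if_not_P) (use False in auto)
  next
    case True
    then have "hr rk (point_mset I)" by (simp add: hr_point_mset[OF fin])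
    then obtain Q where Q: "polymatroid m a Q" "\<And>N. hr_weight m rk (point_mset I + N) = hr_weight m Q N"
      "\<And>A k. A \<subseteq> {1..m} \<Longrightarrow>
       k \<le> Q A \<longleftrightarrow> (\<forall>N. N \<subseteq># point_mset I \<longrightarrow> k + size N \<le> rk (A \<union> \<Union> (set_mset N)))"
      using truncation_exists[OF P point_mset_subset[OF I]] by blast
    have thr: "k \<le> Q A \<longleftrightarrow> (\<forall>T\<subseteq>I. k + card T \<le> rk (A \<union> fst ` T))" if "A \<subseteq> {1..m}" for A k
      using Q(3)[OF that, of k] all_subseteq_point_mset[OF fin, of "\<lambda>n B. k + n \<le> rk (A \<union> B)"] by simp
    have "k \<le> Q {1..m} \<longleftrightarrow> k \<le> card C" for k
    proof -
      have "{1..m} \<union> fst ` T = {1..m}" if "T \<subseteq> I" for T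
        using that I fst_Etil by blast
      then have "k \<le> Q {1..m} \<longleftrightarrow> (\<forall>T\<subseteq>I. k + card T \<le> rk {1..m})"
        using thr[of "{1..m}" k] by simp
      also have "\<dots> \<longleftrightarrow> k + card I \<le> rk {1..m}"
        using card_mono[OF fin] by (meson add_left_mono order_refl order_trans)
      finally show ?thesis using card by linarith
    qed
    then have QE: "card C = Q {1..m}" by (metis order_antisym order_refl)
    have "hdeg m rk (hmon (point_mset I) * (\<Prod>F\<in>C. xpoly m F)) = (if \<forall>F\<in>C. is_flat m Q F then 1 else 0)"
      unfolding hdeg_hmon_mult[OF Q(2)] by (rule hdeg_chain[OF Q(1) C QE])
    also have "(\<forall>F\<in>C. is_flat m Q F) \<longleftrightarrow> (\<forall>F\<in>C. is_flat m rk F \<and>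
       (\<forall>T. T \<subseteq> I - preim m a F \<longrightarrow> T \<noteq> {} \<longrightarrow> rk F + card T < rk (F \<union> fst ` T)))"
      using flat_truncation_iff[OF P Q(1) I thr] C(1) by (intro ball_cong refl) blast
    finally show ?thesis by (subst eqTrueI[OF True]) (simp only: simp_thms)
  qed
qed

text \<open>Only the maximal flat \<open>L\<close> of rank 0 of the rank-one truncation of \<open>rk\<close> along \<open>M\<close>
  contributes to the sum, and \<open>M\<close> satisfies the Hall--Rado condition for \<open>rk'\<close> iff \<open>L\<close> is
  among the sets summed over.\<close>

lemma hdeg_elementary_quotient:
  assumes P: "polymatroid m a rk" and P': "polymatroid m a rk'"
    and rk: "\<And>A. A \<subseteq> {1..m} \<Longrightarrow> rk A = rk' A + (if \<delta> A then 1 else 0)"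
    and mono: "\<And>A B. A \<subseteq> B \<Longrightarrow> B \<subseteq> {1..m} \<Longrightarrow> \<delta> A \<Longrightarrow> \<delta> B"
    and top: "\<delta> {1..m}"
  shows "hdeg m rk ((\<Sum>T | T \<subset> {1..m} \<and> \<not> \<delta> T. xpoly m T) * f) = hdeg m rk' f"
proof -
  let ?D = "{T. T \<subset> {1..m} \<and> \<not> \<delta> T}"
  have finD: "finite ?D" by (rule finite_subset[of _ "Pow {1..m}"]) auto
  have "hdeg m rk ((\<Sum>T\<in>?D. xpoly m T) * hmon M) = hdeg m rk' (1 * hmon M)" for M
  proof -
    have comm: "(\<Sum>T\<in>?D. xpoly m T) * hmon M = hmon M * (\<Sum>T\<in>?D. xpoly m T)"
      by (rule mult.commute)
    show ?thesis
    proof (cases "(\<forall>S\<in>#M. S \<subseteq> {1..m}) \<and> hr rk M")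
      case False
      have "\<not> ((\<forall>S\<in>#M. S \<subseteq> {1..m}) \<and> hr rk' M)"
      proof
        assume *: "(\<forall>S\<in>#M. S \<subseteq> {1..m}) \<and> hr rk' M"
        have "size N \<le> rk (\<Union> (set_mset N))" if N: "N \<subseteq># M" for N
          using * N rk[OF Union_mset_subset[of M "{1..m}" N]] by (fastforce simp: hr_def)
        then show False using False * by (auto simp: hr_def)
      qed
      then have "hdeg m rk' (1 * hmon M) = 0" by (auto simp: hr_weight_def)
      moreover have "hdeg m rk ((\<Sum>T\<in>?D. xpoly m T) * hmon M) = 0"
        unfolding comm using False hdeg_not_hr hdeg_not_subset by blast
      ultimately show ?thesis by simp
    next
      case True
      note ME = conjunct1[OF True] and hrM = conjunct2[OF True]
      obtain Q where Q: "polymatroid m a Q" "\<And>N. hr_weight m rk (M + N) = hr_weight m Q N"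
        "\<And>A k. A \<subseteq> {1..m} \<Longrightarrow>
         k \<le> Q A \<longleftrightarrow> (\<forall>N. N \<subseteq># M \<longrightarrow> k + size N \<le> rk (A \<union> \<Union> (set_mset N)))"
        using truncation_exists[OF P ME hrM] by blast
      have UE: "\<Union> (set_mset N) \<subseteq> {1..m}" if "N \<subseteq># M" for N
        by (rule Union_mset_subset[OF ME that])
      have top_thr: "k \<le> Q {1..m} \<longleftrightarrow> k + size M \<le> rk {1..m}" for k
      proof -
        have "{1..m} \<union> \<Union> (set_mset N) = {1..m}" if "N \<subseteq># M" for N using UE[OF that] by blast
        then have "k \<le> Q {1..m} \<longleftrightarrow> (\<forall>N. N \<subseteq># M \<longrightarrow> k + size N \<le> rk {1..m})"
          using Q(3)[of "{1..m}" k] by simp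
        also have "\<dots> \<longleftrightarrow> k + size M \<le> rk {1..m}"
          using size_mset_mono by (meson add_left_mono subset_mset.order_refl order_trans)
        finally show ?thesis .
      qed
      have "Q {1..m} + size M = rk {1..m}"
        using top_thr[of 0] top_thr[of "Q {1..m}"] top_thr[of "rk {1..m} - size M"] by linarith
      then have QE: "Q {1..m} = 1 \<longleftrightarrow> size M = rk' {1..m}"
        using rk[of "{1..m}"] top by auto
      have lhs: "hdeg m rk ((\<Sum>T\<in>?D. xpoly m T) * hmon M) = (\<Sum>T\<in>?D. hdeg m Q (xpoly m T))"
        unfolding comm hdeg_hmon_mult[OF Q(2)] by (simp add: hdeg_def lin_sum)
      show ?thesis
      proof (cases "Q {1..m} = 1")
        case False
        \<comment> \<open>All h-variables have degree 1, so a single x is seen only in rank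
          1.\<close>
        have "hdeg m Q (xpoly m T) = 0" for T
        proof -
          have "hdeg m Q (hvar S) = 0" for S
            using False by (auto simp: hvar_def hr_weight_def) (simp add: hdeg_def)
          then show ?thesis using hdeg_xpoly_mult[of m Q T 1] by simp
        qed
        then show ?thesis unfolding lhs using False QE by (simp add: hr_weight_def)
      next
        case Q1: True
        define L where "L = {e \<in> {1..m}. Q {e} = 0}"
        have LE: "L \<subseteq> {1..m}" by (auto simp: L_def)
        have QL: "Q L = 0"
        proof -
          have "A \<subseteq> L \<Longrightarrow> Q A = 0" if "finite A" for A using that
          proof (induction A)
            case empty
            then show ?case by (simp add: polymatroid_empty[OF Q(1)])
          next
            case (insert e A)
            have "Q ({e} \<union> A) + Q ({e} \<inter> A) \<le> Q {e} + Q A"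
              by (rule polymatroid_submod[OF Q(1)]) (use insert LE in auto)
            then show ?case using insert by (auto simp: L_def)
          qed
          then show ?thesis using LE finite_subset by blast
        qed
        have L_sub: "A \<subseteq> L" if A: "A \<subseteq> {1..m}" "Q A = 0" for A
        proof
          fix e assume "e \<in> A"
          then have "Q {e} \<le> Q A" using A by (intro polymatroid_mono[OF Q(1)]) auto
          then show "e \<in> L" using A \<open>e \<in> A\<close> by (auto simp: L_def)
        qed
        have "is_flat m Q T \<longleftrightarrow> T = L" if T: "T \<subset> {1..m}" for T
        proof
          assume flat: "is_flat m Q T"
          then have "Q T = 0" using flat_psubset_rank_less[OF Q(1) flat T] Q1 by simp
          then have "T \<subseteq> L" using L_sub T by auto
          then show "T = L" using flat_psubset_rank_less[OF Q(1) flat, of L] LE QL by auto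
        next
          assume "T = L"
          have "0 < Q (insert e L)" if "e \<in> {1..m} - L" for e
            using L_sub[of "insert e L"] that LE by auto
          then show "is_flat m Q T" using \<open>T = L\<close> LE QL by (auto simp: is_flat_def)
        qed
        then have "hdeg m Q (xpoly m T) = (if T = L then 1 else 0)" if "T \<subset> {1..m}" for T
          using hdeg_chain[OF Q(1), of "{T}"] that Q1 by simp
        then have "(\<Sum>T\<in>?D. hdeg m Q (xpoly m T)) = (\<Sum>T\<in>?D. if T = L then 1 else 0)"
          by (intro sum.cong) auto
        also have "\<dots> = (if \<delta> L then 0 else 1)"
          using finD LE QL Q1 by auto
        finally have lhs': "hdeg m rk ((\<Sum>T\<in>?D. xpoly m T) * hmon M) = (if \<delta> L then 0 else 1)"
          unfolding lhs .
        \<comment> \<open>If \<delta> holds at L, some N is tight on L with its union, and there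
          \<open>rk'\<close> is one less than \<open>rk\<close>. Conversely, a violation of
          \<open>rk'\<close> at N means that \<open>rk\<close> is tight at the union of N and
          \<delta> holds there; that union has Q-rank 0, lies in L, and passes \<delta> on to
          L.\<close>
        have "hr rk' M \<longleftrightarrow> \<not> \<delta> L"
        proof
          assume hr': "hr rk' M"
          show "\<not> \<delta> L"
          proof
            assume "\<delta> L"
            have "\<not> 1 \<le> Q L" using QL by simp
            then obtain N where N: "N \<subseteq># M" "rk (L \<union> \<Union> (set_mset N)) < 1 + size N"
              using Q(3)[OF LE, of 1] by (auto simp: not_le)
            have "size N \<le> rk' (\<Union> (set_mset N))" using hr' N(1) by (simp add: hr_def)
            also have "\<dots> \<le> rk' (L \<union> \<Union> (set_mset N))"
              by (rule polymatroid_mono[OF P']) (use LE UE[OF N(1)] in auto)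
            also have "\<dots> < rk (L \<union> \<Union> (set_mset N))"
            proof -
              have sub: "L \<union> \<Union> (set_mset N) \<subseteq> {1..m}" using LE UE[OF N(1)] by auto
              have "\<delta> (L \<union> \<Union> (set_mset N))" by (rule mono[OF _ sub \<open>\<delta> L\<close>]) auto
              then show ?thesis using rk[OF sub] by simp
            qed
            finally show False using N(2) by simp
          qed
        next
          assume nL: "\<not> \<delta> L"
          show "hr rk' M"
            unfolding hr_def
          proof (intro allI impI, rule ccontr)
            fix N assume N: "N \<subseteq># M" "\<not> size N \<le> rk' (\<Union> (set_mset N))"
            have "size N \<le> rk (\<Union> (set_mset N))" using hrM N(1) by (simp add: hr_def)
            then have *: "\<delta> (\<Union> (set_mset N))" "rk (\<Union> (set_mset N)) \<le> size N"
              using N(2) rk[OF UE[OF N(1)]] by (auto split: if_splits)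
            have "\<not> 1 \<le> Q (\<Union> (set_mset N))"
              unfolding Q(3)[OF UE[OF N(1)]] using N(1) *(2) by (auto intro!: exI[of _ N])
            then have "\<Union> (set_mset N) \<subseteq> L" using L_sub[OF UE[OF N(1)]] by simp
            then show False using mono[OF _ LE *(1)] nL by blast
          qed
        qed
        then show ?thesis unfolding lhs' using QE Q1 ME by (simp add: hr_weight_def)
      qed
    qed
  qed
  from hdeg_mult_eqI[OF this] show ?thesis by simp
qed

section \<open>Substituting the $h_S$ for the rays\<close>

definition mono_eval :: "('x \<Rightarrow> 'b::comm_ring_1) \<Rightarrow> ('x \<Rightarrow>\<^sub>0 nat) \<Rightarrow> 'b" where
  "mono_eval v \<mu> = (\<Prod>\<rho>\<in>Poly_Mapping.keys \<mu>. v \<rho> ^ Poly_Mapping.lookup \<mu> \<rho>)"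

lemma mono_eval_superset:
  "finite K \<Longrightarrow> Poly_Mapping.keys \<mu> \<subseteq> K \<Longrightarrow> mono_eval v \<mu> = (\<Prod>\<rho>\<in>K. v \<rho> ^ Poly_Mapping.lookup \<mu> \<rho>)"
  unfolding mono_eval_def by (rule prod.mono_neutral_left) (auto simp: in_keys_iff)

lemma mono_eval_add: "mono_eval v (\<mu> + \<nu>) = mono_eval v \<mu> * mono_eval v \<nu>"
proof -
  let ?K = "Poly_Mapping.keys \<mu> \<union> Poly_Mapping.keys \<nu>"
  have "mono_eval v (\<mu> + \<nu>) = (\<Prod>\<rho>\<in>?K. v \<rho> ^ Poly_Mapping.lookup (\<mu> + \<nu>) \<rho>)"
    by (rule mono_eval_superset) (auto simp: in_keys_iff lookup_add)
  moreover have "mono_eval v \<mu> = (\<Prod>\<rho>\<in>?K. v \<rho> ^ Poly_Mapping.lookup \<mu> \<rho>)"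
    "mono_eval v \<nu> = (\<Prod>\<rho>\<in>?K. v \<rho> ^ Poly_Mapping.lookup \<nu> \<rho>)"
    by (rule mono_eval_superset; auto)+
  ultimately show ?thesis by (simp add: lookup_add power_add prod.distrib)
qed

text \<open>Sending e_j to h of {fst j} turns the linear relations into identities. Labels that are
  not rays go to 0, which disposes of the Stanley--Reisner generators containing them.\<close>

definition lbl_poly :: "nat \<Rightarrow> (nat \<Rightarrow> nat) \<Rightarrow> lbl \<Rightarrow> hpoly" where
  "lbl_poly m a \<rho> = (case \<rho> of Pos j \<Rightarrow> if j \<in> Etil m a then hvar {fst j} else 0
                           | Neg F \<Rightarrow> if F \<subset> {1..m} then xpoly m F else 0)"

definition to_h :: "nat \<Rightarrow> (nat \<Rightarrow> nat) \<Rightarrow> cpoly \<Rightarrow> hpoly" where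
  "to_h m a = lin (mono_eval (lbl_poly m a))"

lemma to_h_add: "to_h m a (f + g) = to_h m a f + to_h m a g"
  and to_h_diff: "to_h m a (f - g) = to_h m a f - to_h m a g"
  and to_h_uminus: "to_h m a (- f) = - to_h m a f"
  and to_h_zero: "to_h m a 0 = 0"
  and to_h_sum: "to_h m a (sum h A) = (\<Sum>i\<in>A. to_h m a (h i))"
  and to_h_mult: "to_h m a (f * g) = to_h m a f * to_h m a g"
  and to_h_of_int_mult: "to_h m a (of_int k * f) = of_int k * to_h m a f"
  by (simp_all add: to_h_def lin_add lin_diff lin_uminus lin_sum lin_of_int_mult
      lin_mult[of "mono_eval (lbl_poly m a)", OF mono_eval_add])

lemma to_h_one: "to_h m a 1 = 1"
  unfolding to_h_def single_one[symmetric] lin_single by (simp add: mono_eval_def)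

lemma to_h_prod: "to_h m a (prod h A) = (\<Prod>i\<in>A. to_h m a (h i))"
  by (induction A rule: infinite_finite_induct) (auto simp: to_h_one to_h_mult)

lemma to_h_Var: "to_h m a (Var \<rho>) = lbl_poly m a \<rho>"
  by (simp add: to_h_def Var_def mono_eval_def)

lemma to_h_monom: "to_h m a (monom R) = (\<Prod>\<rho>\<in>R. lbl_poly m a \<rho>)"
  by (simp add: monom_def to_h_prod to_h_Var)

text \<open>After exchanging the sums, the coefficient of \<open>hvar U\<close> is an alternating
  sum over the T inside U that do not contain S. It equals [U = {}] - [U = S], and the first term
  meets \<open>hvar {} = 0\<close>.\<close>

lemma sum_xpoly:
  assumes S: "S \<noteq> {}" "S \<subseteq> {1..m}"
  shows "(\<Sum>T | T \<subset> {1..m} \<and> \<not> S \<subseteq> T. xpoly m T) = hvar S"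
proof -
  let ?E = "{1..m}"
  have dom: "{T. T \<subset> ?E \<and> \<not> S \<subseteq> T} = {T \<in> Pow ?E. \<not> S \<subseteq> T}" using S by auto
  have inner: "(\<Sum>T | T \<in> {T \<in> Pow ?E. \<not> S \<subseteq> T} \<and> T \<subseteq> U. (-1) ^ (card T + card U) :: hpoly)
      = (if {} = U then 1 else 0) - (if S = U then 1 else 0)" if U: "U \<subseteq> ?E" for U
  proof -
    have fin: "finite U" using U finite_subset by blast
    let ?s = "\<lambda>T. (-1) ^ (card T + card U) :: hpoly"
    have alt: "sum ?s {T. A \<subseteq> T \<and> T \<subseteq> U} = (if A = U then 1 else 0)" for A
    proof -
      have "sum ?s {T. A \<subseteq> T \<and> T \<subseteq> U} = (\<Sum>T | A \<subseteq> T \<and> T \<subseteq> U. (-1) ^ (card U + card T))"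
        by (rule sum.cong) (simp_all add: add.commute)
      also have "\<dots> = (if A = U then (-1) ^ (card U + card U) else 0)"
        by (rule sum_alternating_interval[OF fin])
      finally show ?thesis by (simp flip: mult_2)
    qed
    let ?X = "{T. T \<in> {T \<in> Pow ?E. \<not> S \<subseteq> T} \<and> T \<subseteq> U}"
    have fins: "finite {T. T \<subseteq> U \<and> P T}" for P
      using fin by (auto intro: finite_subset[of _ "Pow U"])
    have X: "?X = {T. T \<subseteq> U \<and> \<not> S \<subseteq> T}" using U by auto
    have "sum ?s {T. {} \<subseteq> T \<and> T \<subseteq> U} = sum ?s ({T. T \<subseteq> U \<and> \<not> S \<subseteq> T} \<union> {T. T \<subseteq> U \<and> S \<subseteq> T})"
      by (rule sum.cong) auto
    also have "\<dots> = sum ?s ?X + sum ?s {T. S \<subseteq> T \<and> T \<subseteq> U}"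
      unfolding X conj_commute[of "S \<subseteq> _"] by (rule sum.union_disjoint) (use fins in auto)
    finally show ?thesis unfolding alt by (simp only: add_diff_cancel_right')
  qed
  have "(\<Sum>T | T \<subset> ?E \<and> \<not> S \<subseteq> T. xpoly m T)
      = - (\<Sum>T\<in>{T \<in> Pow ?E. \<not> S \<subseteq> T}. \<Sum>U | U \<in> Pow ?E \<and> T \<subseteq> U. (-1) ^ (card T + card U) * hvar U)"
    unfolding dom xpoly_def sum_negf by (simp add: conj_commute)
  also have "\<dots> = - (\<Sum>U\<in>Pow ?E. \<Sum>T | T \<in> {T \<in> Pow ?E. \<not> S \<subseteq> T} \<and> T \<subseteq> U. (-1) ^ (card T + card U) * hvar U)"
    by (subst sum.swap_restrict) auto
  also have "\<dots> = - (\<Sum>U\<in>Pow ?E. ((if {} = U then 1 else 0) - (if S = U then 1 else 0)) * hvar U)"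
    unfolding sum_distrib_right[symmetric]
    by (intro arg_cong[of _ _ uminus] sum.cong refl arg_cong2[of _ _ _ _ "(*)"] inner) auto
  also have "\<dots> = - (\<Sum>U\<in>Pow ?E. if S = U then - hvar U else 0)"
    by (intro arg_cong[of _ _ uminus] sum.cong) (auto simp: hvar_def)
  also have "\<dots> = hvar S" using S by simp
  finally show ?thesis .
qed

lemma to_h_h_S:
  assumes "S \<noteq> {}" "S \<subseteq> {1..m}"
  shows "to_h m a (h_S m S) = hvar S"
proof -
  have "to_h m a (h_S m S) = (\<Sum>T | T \<subset> {1..m} \<and> \<not> S \<subseteq> T. xpoly m T)"
    unfolding h_S_def x_S_def to_h_sum to_h_Var by (intro sum.cong) (auto simp: lbl_poly_def)
  then show ?thesis unfolding sum_xpoly[OF assms] .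
qed

lemma prod_hvar_points:
  "finite I \<Longrightarrow> (\<Prod>j\<in>I. hvar {fst j}) = hmon (point_mset I)"
proof (induction I rule: finite_induct)
  case empty
  then show ?case by (simp add: point_mset_def hmon_empty)
next
  case (insert j I)
  then show ?case by (simp add: point_mset_def hvar_def hmon_mult)
qed

lemma to_h_cone:
  assumes I: "I \<subseteq> Etil m a" and C: "\<forall>F\<in>C. F \<subset> {1..m}"
  shows "to_h m a (monom (cone_rays I C)) = hmon (point_mset I) * (\<Prod>F\<in>C. xpoly m F)"
proof -
  have fin: "finite I" "finite C"
    using I finite_Etil finite_subset finite_proper_subsets[OF C] by blast+
  have "to_h m a (monom (cone_rays I C)) = (\<Prod>\<rho>\<in>Pos ` I. lbl_poly m a \<rho>) * (\<Prod>\<rho>\<in>Neg ` C. lbl_poly m a \<rho>)"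
    unfolding to_h_monom cone_rays_def by (rule prod.union_disjoint) (use fin in auto)
  also have "(\<Prod>\<rho>\<in>Pos ` I. lbl_poly m a \<rho>) = (\<Prod>j\<in>I. hvar {fst j})"
    using I by (subst prod.reindex) (auto simp: inj_on_def lbl_poly_def intro!: prod.cong)
  also have "(\<Prod>\<rho>\<in>Neg ` C. lbl_poly m a \<rho>) = (\<Prod>F\<in>C. xpoly m F)"
    using C by (subst prod.reindex) (auto simp: inj_on_def lbl_poly_def intro!: prod.cong)
  finally show ?thesis by (simp add: prod_hvar_points fin)
qed

lemma hmon_power: "hmon {#S#} ^ n = hmon (replicate_mset n S)"
  by (induction n) (auto simp: hmon_empty hmon_mult)

text \<open>Apart from labels that are not rays, compatibility fails only through two incomparable
  members of C or a full fibre over some i outside a member F. A violating set A may be shrunk to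
  one such i, so the two vanishing lemmas cover all cases.\<close>

lemma hdeg_not_cone:
  assumes P: "polymatroid m a rk" and R: "finite R" "\<not> is_cone m a R"
  shows "hdeg m rk (to_h m a (monom R) * f) = 0"
proof (cases "\<exists>\<rho>\<in>R. lbl_poly m a \<rho> = 0")
  case True
  then have "to_h m a (monom R) = 0" unfolding to_h_monom by (rule prod_zero[OF R(1)])
  then show ?thesis by (simp add: hdeg_def)
next
  case False
  define I where "I = {j. Pos j \<in> R}"
  define C where "C = {F. Neg F \<in> R}"
  have "\<rho> \<in> R \<longleftrightarrow> \<rho> \<in> cone_rays I C" for \<rho>
    by (cases \<rho>) (auto simp: I_def C_def cone_rays_def)
  then have RIC: "R = cone_rays I C" by blast
  have I: "I \<subseteq> Etil m a"
  proof
    fix j assume "j \<in> I"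
    then have "lbl_poly m a (Pos j) \<noteq> 0" using False unfolding I_def by blast
    then show "j \<in> Etil m a" by (auto simp: lbl_poly_def split: if_splits)
  qed
  have C: "\<forall>F\<in>C. F \<subset> {1..m}"
  proof
    fix F assume "F \<in> C"
    then have "lbl_poly m a (Neg F) \<noteq> 0" using False unfolding C_def by blast
    then show "F \<subset> {1..m}" by (auto simp: lbl_poly_def split: if_splits)
  qed
  have finC: "finite C" by (rule finite_proper_subsets[OF C])
  have finI: "finite I" using I finite_Etil finite_subset by blast
  have "\<not> compatible m a I C" using R(2) RIC by (auto simp: is_cone_def)
  then consider (inc) F G where "F \<in> C" "G \<in> C" "\<not> F \<subseteq> G" "\<not> G \<subseteq> F"
    | (full) A F where "A \<subseteq> {1..m}" "preim m a A \<subseteq> I" "F \<in> C" "\<not> A \<subseteq> F"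
    using I C unfolding compatible_def by blast
  then show ?thesis
  proof cases
    case inc
    have "(\<Prod>F\<in>C. xpoly m F) = xpoly m F * (xpoly m G * (\<Prod>F\<in>C - {F} - {G}. xpoly m F))"
      using inc finC by (subst prod.remove[of C F]) (auto simp: prod.remove[of "C - {F}" G])
    then have "to_h m a (monom R) * f = xpoly m F * xpoly m G *
        ((\<Prod>F\<in>C - {F} - {G}. xpoly m F) * hmon (point_mset I) * f)"
      unfolding RIC to_h_cone[OF I C] by (simp add: mult_ac)
    then show ?thesis using hdeg_incomparable[OF P _ _ inc(3,4)] inc C by simp
  next
    case full
    then obtain i where i: "i \<in> A" "i \<notin> F" by blast
    have iE: "i \<in> {1..m}" using i full by auto
    define J where "J = preim m a {i}"
    have JI: "J \<subseteq> I" using i full by (auto simp: J_def preim_def)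
    have finJ: "finite J" using JI finI finite_subset by blast
    have "(\<Prod>j\<in>J. hvar {fst j}) = (\<Prod>j\<in>J. hmon {#{i}#})"
      by (rule prod.cong) (auto simp: J_def preim_def hvar_def)
    also have "\<dots> = hmon {#{i}#} ^ a i"
      using card_preim[of "{i}" m a] iE by (simp add: J_def)
    also have "\<dots> = hmon (replicate_mset (a i) {i})"
      by (rule hmon_power)
    finally have J: "(\<Prod>j\<in>J. hvar {fst j}) = hmon (replicate_mset (a i) {i})" .
    have "hmon (point_mset I) = (\<Prod>j\<in>J. hvar {fst j}) * (\<Prod>j\<in>I - J. hvar {fst j})"
      unfolding prod_hvar_points[OF finI, symmetric] using prod.subset_diff[OF JI finI]
      by (simp add: mult.commute)
    moreover have "(\<Prod>F\<in>C. xpoly m F) = xpoly m F * (\<Prod>F\<in>C - {F}. xpoly m F)"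
      using full finC by (simp add: prod.remove)
    ultimately have "to_h m a (monom R) * f = xpoly m F * hmon (replicate_mset (a i) {i}) *
        ((\<Prod>F\<in>C - {F}. xpoly m F) * (\<Prod>j\<in>I - J. hvar {fst j}) * f)"
      unfolding RIC to_h_cone[OF I C] J by (simp add: mult_ac)
    then show ?thesis using hdeg_full_fibre[OF P iE i(2)] by simp
  qed
qed

text \<open>Linear generators lie in the kernel of \<open>to_h\<close> itself; Stanley--Reisner
  generators are killed by \<open>hdeg\<close> together with all their multiples, which is why the
  vanishing lemmas carry a free factor f.\<close>

lemma hdeg_ideal:
  assumes P: "polymatroid m a rk" and f: "f \<in> ideal_of (chow_rels m a)"
  shows "hdeg m rk (to_h m a f) = 0"
  using f
proof (induction rule: ideal_of.induct)
  case zero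
  then show ?case by (simp add: to_h_zero hdeg_def)
next
  case (step g x c)
  have "hdeg m rk (to_h m a g * to_h m a c) = 0"
  proof -
    from step(1) consider (cone) R where "g = monom R" "finite R" "\<not> is_cone m a R"
      | (lin) j where "j \<in> Etil m a"
        "g = Var (Pos j) - (\<Sum>S \<in> {S. S \<subset> {1..m} \<and> fst j \<notin> S}. Var (Neg S))"
      unfolding chow_rels_def by blast
    then show ?thesis
    proof cases
      case cone
      then show ?thesis using hdeg_not_cone[OF P] by simp
    next
      case lin
      have j: "fst j \<in> {1..m}" using lin(1) by (auto simp: Etil_def)
      have "g = Var (Pos j) - h_S m {fst j}"
        unfolding lin(2) h_S_def x_S_def by simp
      then have "to_h m a g = 0"
        using to_h_h_S[of "{fst j}" m a] j lin(1) by (simp add: to_h_diff to_h_Var lbl_poly_def)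
      then show ?thesis by (simp add: hdeg_def)
    qed
  qed
  then show ?case using step
    by (simp add: to_h_add to_h_mult mult.commute) (simp add: hdeg_def lin_add)
qed

section \<open>The Chow ring is spanned by squarefree monomials\<close>

lemma compatible_subsets: "compatible m a I C \<Longrightarrow> I \<subseteq> Etil m a"
  and compatible_proper: "compatible m a I C \<Longrightarrow> \<forall>F\<in>C. F \<subset> {1..m}"
  and compatible_chain: "compatible m a I C \<Longrightarrow> \<forall>F\<in>C. \<forall>G\<in>C. F \<subseteq> G \<or> G \<subseteq> F"
  by (simp_all add: compatible_def)

lemma compatible_full:
  "compatible m a I C \<Longrightarrow> i \<in> {1..m} \<Longrightarrow> preim m a {i} \<subseteq> I \<Longrightarrow> F \<in> C \<Longrightarrow> i \<in> F"
  unfolding compatible_def by (metis empty_subsetI insert_subset)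

lemma compatible_not_full:
  assumes "compatible m a I C" "i \<in> {1..m}" "F \<in> C" "i \<notin> F"
  obtains j where "j \<in> Etil m a" "fst j = i" "j \<notin> I"
proof -
  have "\<not> preim m a {i} \<subseteq> I" using compatible_full[OF assms(1,2) _ assms(3)] assms(4) by blast
  then obtain j where "j \<in> preim m a {i}" "j \<notin> I" by blast
  then show ?thesis using that[of j] by (simp add: preim_def)
qed

lemma compatible_finite: "compatible m a I C \<Longrightarrow> finite I \<and> finite C"
  using compatible_subsets finite_Etil finite_subset finite_proper_subsets[OF compatible_proper] by metis

lemma cone_rays_eq_iff: "cone_rays I C = cone_rays I' C' \<longleftrightarrow> I = I' \<and> C = C'"
  by (auto simp: cone_rays_def)

lemma card_cone_rays: "finite I \<Longrightarrow> finite C \<Longrightarrow> card (cone_rays I C) = card I + card C"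
  unfolding cone_rays_def by (subst card_Un_disjoint) (auto simp: card_image inj_on_def)

lemma finite_cone_rays: "finite I \<Longrightarrow> finite C \<Longrightarrow> finite (cone_rays I C)"
  by (simp add: cone_rays_def)

lemma finite_Neg: "finite {S. S \<subset> {k..m::nat} \<and> P S}"
  by (rule finite_subset[of _ "Pow {k..m}"]) auto

lemma sum_Var_Neg: "(\<Sum>\<rho>\<in>Neg ` A. Var \<rho>) = (\<Sum>S\<in>A. Var (Neg S))"
  by (subst sum.reindex) (auto simp: inj_on_def)

lemma linear_relation:
  assumes "j \<in> Etil m a"
  shows "Var (Pos j) - (\<Sum>S | S \<subset> {1..m} \<and> fst j \<notin> S. Var (Neg S)) \<in> ideal_of (chow_rels m a)"
  by (rule ideal_of_gen) (use assms in \<open>unfold chow_rels_def, blast\<close>)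

text \<open>Subtracting two linear relations cancels the sets that miss both coordinates; what
  remains separates the two elements \<open>fst j\<close> and \<open>fst j'\<close>.\<close>

lemma linear_relation_diff:
  assumes "j \<in> Etil m a" "j' \<in> Etil m a"
  shows "Var (Pos j) - Var (Pos j') - ((\<Sum>S | S \<subset> {1..m} \<and> fst j \<notin> S \<and> fst j' \<in> S. Var (Neg S))
    - (\<Sum>S | S \<subset> {1..m} \<and> fst j' \<notin> S \<and> fst j \<in> S. Var (Neg S))) \<in> ideal_of (chow_rels m a)"
proof -
  have split: "(\<Sum>S | S \<subset> {1..m} \<and> i \<notin> S. Var (Neg S)) =
      (\<Sum>S | S \<subset> {1..m} \<and> i \<notin> S \<and> k \<in> S. Var (Neg S)) + (\<Sum>S | S \<subset> {1..m} \<and> i \<notin> S \<and> k \<notin> S. Var (Neg S))"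
    for i k
    by (subst sum.union_disjoint[symmetric]) (auto intro!: sum.cong finite_Neg)
  have sym: "(\<Sum>S | S \<subset> {1..m} \<and> fst j \<notin> S \<and> fst j' \<notin> S. Var (Neg S))
     = (\<Sum>S | S \<subset> {1..m} \<and> fst j' \<notin> S \<and> fst j \<notin> S. Var (Neg S))"
    by (rule sum.cong) auto
  show ?thesis
    using ideal_of_diff[OF linear_relation[OF assms(1)] linear_relation[OF assms(2)]]
    unfolding split[of "fst j" "fst j'"] split[of "fst j'" "fst j"] sym by (simp add: algebra_simps)
qed

text \<open>This is where the unimodularity of the fan enters.\<close>

lemma cone_ray_exchange:
  assumes comp: "compatible m a I C" and \<rho>: "\<rho> \<in> cone_rays I C"
  obtains A B where "finite A" "finite B" "A \<inter> cone_rays I C = {}" "B \<inter> cone_rays I C = {}"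
    "Var \<rho> - (sum Var A - sum Var B) \<in> ideal_of (chow_rels m a)"
proof -
  note I = compatible_subsets[OF comp] and proper = compatible_proper[OF comp]
    and chain = compatible_chain[OF comp]
  have finC: "finite C" using compatible_finite[OF comp] by simp
  from \<rho> consider (pos) j where "\<rho> = Pos j" "j \<in> I" | (neg) F where "\<rho> = Neg F" "F \<in> C"
    by (auto simp: cone_rays_def)
  then show ?thesis
  proof cases
    case pos
    have jE: "j \<in> Etil m a" using pos I by auto
    show ?thesis
    proof (cases "preim m a {fst j} \<subseteq> I")
      case True
      \<comment> \<open>With a full fibre over \<open>fst j\<close> every chain member contains
        \<open>fst j\<close>, so the relation of j involves no negative ray of the cone.\<close>
      have "fst j \<in> F" if "F \<in> C" for F
        using compatible_full[OF comp _ True that] jE by (auto simp: Etil_def)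
      then show ?thesis
        using linear_relation[OF jE] pos
        by (intro that[of "Neg ` {S. S \<subset> {1..m} \<and> fst j \<notin> S}" "{}"])
           (auto simp: sum_Var_Neg cone_rays_def finite_Neg)
    next
      case False
      then obtain j' where j': "j' \<in> Etil m a" "fst j' = fst j" "j' \<notin> I" by (auto simp: preim_def)
      have "Var (Pos j) - Var (Pos j') \<in> ideal_of (chow_rels m a)"
        using ideal_of_diff[OF linear_relation[OF jE] linear_relation[OF j'(1)]] j'(2) by simp
      then show ?thesis using j' pos by (intro that[of "{Pos j'}" "{}"]) (auto simp: cone_rays_def)
    qed
  next
    case neg
    have FE: "F \<subset> {1..m}" using neg proper by auto
    define U where "U = {G \<in> insert {1..m} C. F \<subset> G}"
    have "finite U" "U \<noteq> {}" "\<forall>G\<in>U. \<forall>H\<in>U. G \<subseteq> H \<or> H \<subseteq> G"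
      using finC FE chain proper by (auto simp: U_def)
    then obtain G where "G \<in> U" and G_least: "\<And>H. H \<in> U \<Longrightarrow> G \<subseteq> H"
      using finite_chain_has_least by blast
    then have G: "G \<in> insert {1..m} C" "F \<subset> G" by (auto simp: U_def)
    \<comment> \<open>G is the successor of F in the chain, so the chain members missing b are those
      inside F. As b is outside F, its fibre is not full and offers a point j off I.\<close>
    obtain b where b: "b \<in> G" "b \<notin> F" using G by auto
    have bE: "b \<in> {1..m}" using b G(1) proper by blast
    have b_iff: "T \<subseteq> F" if "T \<in> C" "b \<notin> T" for T
      using that G_least[of T] b(1) chain neg(2) unfolding U_def by blast
    obtain j where j: "j \<in> Etil m a" "fst j = b" "j \<notin> I"
      using compatible_not_full[OF comp bE neg(2) b(2)] by blast
    show ?thesis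
    proof (cases "\<exists>F'\<in>C. F' \<subset> F")
      case False
      \<comment> \<open>With nothing of C strictly below F, the set F is the only chain member
        missing b, and the relation of j isolates it.\<close>
      let ?B = "{S. S \<subset> {1..m} \<and> b \<notin> S \<and> S \<noteq> F}"
      have "(\<Sum>S | S \<subset> {1..m} \<and> b \<notin> S. Var (Neg S)) = Var (Neg F) + (\<Sum>S\<in>?B. Var (Neg S))"
        using FE b(2) by (subst sum.remove[of _ F]) (auto intro!: finite_Neg sum.cong)
      then have "Var (Neg F) - (Var (Pos j) - (\<Sum>S\<in>?B. Var (Neg S)))
          = - (Var (Pos j) - (\<Sum>S | S \<subset> {1..m} \<and> fst j \<notin> S. Var (Neg S)))"
        by (simp add: j(2))
      also have "\<dots> \<in> ideal_of (chow_rels m a)"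
        by (intro ideal_of_uminus linear_relation j)
      finally have "Var \<rho> - (sum Var {Pos j} - sum Var (Neg ` ?B)) \<in> ideal_of (chow_rels m a)"
        using neg by (simp add: sum_Var_Neg)
      moreover have "S \<notin> C" if "S \<in> ?B" for S using that b_iff[of S] False by blast
      ultimately show ?thesis using j(3)
        by (intro that[of "{Pos j}" "Neg ` ?B"]) (auto simp: cone_rays_def finite_Neg)
    next
      case True
      define U' where "U' = {F'\<in>C. F' \<subset> F}"
      have "finite U'" "U' \<noteq> {}" "\<forall>G\<in>U'. \<forall>H\<in>U'. G \<subseteq> H \<or> H \<subseteq> G"
        using finC chain True unfolding U'_def by auto
      then obtain F' where "F' \<in> U'" and F'_greatest: "\<And>H. H \<in> U' \<Longrightarrow> H \<subseteq> F'"
        using finite_chain_has_greatest by blast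
      then have F': "F' \<in> C" "F' \<subset> F" by (auto simp: U'_def)
      \<comment> \<open>F' is the predecessor of F. Chain members containing b' contain F and those
        missing b lie inside F, so F alone does both; the difference of the relations at b and b'
        isolates it.\<close>
      obtain b' where b': "b' \<in> F" "b' \<notin> F'" using F' by auto
      have b'E: "b' \<in> {1..m}" using b' FE by auto
      have b'_iff: "T \<subset> F" if "T \<in> C" "b' \<notin> T" for T
        using that b' chain neg(2) by blast
      have b'_iff2: "F \<subseteq> T" if "T \<in> C" "b' \<in> T" for T
        using that b' F'_greatest[of T] chain neg(2) unfolding U'_def by blast
      obtain j' where j': "j' \<in> Etil m a" "fst j' = b'" "j' \<notin> I"
        using compatible_not_full[OF comp b'E F'(1) b'(2)] by blast
      let ?A = "{S. S \<subset> {1..m} \<and> b' \<notin> S \<and> b \<in> S}"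
      let ?B = "{S. S \<subset> {1..m} \<and> b \<notin> S \<and> b' \<in> S \<and> S \<noteq> F}"
      have "(\<Sum>S | S \<subset> {1..m} \<and> b \<notin> S \<and> b' \<in> S. Var (Neg S)) = Var (Neg F) + (\<Sum>S\<in>?B. Var (Neg S))"
        using FE b(2) b'(1) by (subst sum.remove[of _ F]) (auto intro!: finite_Neg sum.cong)
      then have "Var (Neg F) - ((Var (Pos j) + (\<Sum>S\<in>?A. Var (Neg S))) - (Var (Pos j') + (\<Sum>S\<in>?B. Var (Neg S))))
          = - (Var (Pos j) - Var (Pos j') - ((\<Sum>S | S \<subset> {1..m} \<and> fst j \<notin> S \<and> fst j' \<in> S. Var (Neg S))
              - (\<Sum>S | S \<subset> {1..m} \<and> fst j' \<notin> S \<and> fst j \<in> S. Var (Neg S))))"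
        by (simp add: j(2) j'(2))
      also have "\<dots> \<in> ideal_of (chow_rels m a)"
        by (intro ideal_of_uminus linear_relation_diff j j')
      finally have rel: "Var (Neg F) - (sum Var (insert (Pos j) (Neg ` ?A)) - sum Var (insert (Pos j') (Neg ` ?B)))
          \<in> ideal_of (chow_rels m a)"
        by (subst (1 2) sum.insert) (auto simp: sum_Var_Neg finite_Neg)
      have "S \<notin> C" if "S \<in> ?A" for S using that b'_iff[of S] b by blast
      moreover have "S \<notin> C" if "S \<in> ?B" for S using that b'_iff2[of S] b_iff[of S] by blast
      ultimately show ?thesis using rel j(3) j'(3) neg(1)
        by (intro that[of "insert (Pos j) (Neg ` ?A)" "insert (Pos j') (Neg ` ?B)"])
           (auto simp: cone_rays_def finite_Neg)
    qed
  qed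
qed


section \<open>Total degree and reduction to squarefree monomials\<close>

definition cmon :: "(lbl \<Rightarrow>\<^sub>0 nat) \<Rightarrow> cpoly" where
  "cmon \<mu> = Poly_Mapping.single \<mu> 1"

definition mdeg :: "('x \<Rightarrow>\<^sub>0 nat) \<Rightarrow> nat" where
  "mdeg \<mu> = (\<Sum>\<rho>\<in>Poly_Mapping.keys \<mu>. Poly_Mapping.lookup \<mu> \<rho>)"

lemma mdeg_superset:
  "finite K \<Longrightarrow> Poly_Mapping.keys \<mu> \<subseteq> K \<Longrightarrow> mdeg \<mu> = (\<Sum>\<rho>\<in>K. Poly_Mapping.lookup \<mu> \<rho>)"
  unfolding mdeg_def by (rule sum.mono_neutral_left) (auto simp: in_keys_iff)

lemma mdeg_add: "mdeg (\<mu> + \<nu>) = mdeg \<mu> + mdeg \<nu>"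
proof -
  let ?K = "Poly_Mapping.keys \<mu> \<union> Poly_Mapping.keys \<nu>"
  have "mdeg (\<mu> + \<nu>) = (\<Sum>\<rho>\<in>?K. Poly_Mapping.lookup (\<mu> + \<nu>) \<rho>)"
    by (rule mdeg_superset) (auto simp: in_keys_iff lookup_add)
  moreover have "mdeg \<mu> = (\<Sum>\<rho>\<in>?K. Poly_Mapping.lookup \<mu> \<rho>)"
    "mdeg \<nu> = (\<Sum>\<rho>\<in>?K. Poly_Mapping.lookup \<nu> \<rho>)"
    by (rule mdeg_superset; auto)+
  ultimately show ?thesis by (simp add: lookup_add sum.distrib)
qed

lemma mdeg_single: "mdeg (Poly_Mapping.single \<rho> n) = n"
  by (simp add: mdeg_def)

lemma mdeg_ge_card: "card (Poly_Mapping.keys \<mu>) \<le> mdeg \<mu>"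
  unfolding mdeg_def card_eq_sum by (rule sum_mono) (auto simp: in_keys_iff)

lemma hom_deg_iff: "hom_deg d f \<longleftrightarrow> (\<forall>\<mu>\<in>Poly_Mapping.keys f. mdeg \<mu> = d)"
  by (simp add: hom_deg_def mdeg_def)

lemma hom_deg_add: "hom_deg d f \<Longrightarrow> hom_deg d g \<Longrightarrow> hom_deg d (f + g)"
  unfolding hom_deg_iff by (metis add.right_neutral in_keys_iff lookup_add)

lemma hom_deg_sum: "(\<And>i. i \<in> A \<Longrightarrow> hom_deg d (f i)) \<Longrightarrow> hom_deg d (sum f A)"
proof (induction A rule: infinite_finite_induct)
  case (insert x F)
  then show ?case by (simp add: hom_deg_add)
qed (simp_all add: hom_deg_iff)

lemma hom_deg_mult: "hom_deg d f \<Longrightarrow> hom_deg e g \<Longrightarrow> hom_deg (d + e) (f * g)"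
  unfolding hom_deg_iff using keys_mult[of f g] by (fastforce simp: mdeg_add)

lemma hom_deg_Var: "hom_deg (Suc 0) (Var \<rho>)"
  by (simp add: hom_deg_iff Var_def mdeg_single)

lemma hom_deg_one: "hom_deg 0 1"
  by (simp add: hom_deg_iff mdeg_def)

lemma hom_deg_prod: "(\<And>i. i \<in> A \<Longrightarrow> hom_deg 1 (f i)) \<Longrightarrow> finite A \<Longrightarrow> hom_deg (card A) (prod f A)"
proof (induction A rule: infinite_finite_induct)
  case (insert x F)
  then show ?case using hom_deg_mult[of 1 "f x" "card F" "prod f F"] by auto
qed (auto simp: hom_deg_one)

lemma monom_cmon: "finite R \<Longrightarrow> monom R = cmon (\<Sum>\<rho>\<in>R. Poly_Mapping.single \<rho> 1)"
proof (induction R rule: finite_induct)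
  case empty
  then show ?case by (simp add: monom_def cmon_def)
next
  case (insert \<rho> R)
  then show ?case by (simp add: monom_def cmon_def Var_def mult_single)
qed

lemma lookup_sum_single:
  "finite R \<Longrightarrow> Poly_Mapping.lookup (\<Sum>\<rho>\<in>R. Poly_Mapping.single \<rho> (c::nat)) \<sigma> = (if \<sigma> \<in> R then c else 0)"
  by (simp add: lookup_sum lookup_single when_def)

lemma cmon_add: "cmon (\<mu> + \<nu>) = cmon \<mu> * cmon \<nu>"
  by (simp add: cmon_def mult_single)

lemma cmon_dvd_support: "\<exists>\<nu>. cmon \<mu> = cmon \<nu> * monom (Poly_Mapping.keys \<mu>)"
proof -
  let ?s = "\<Sum>\<rho>\<in>Poly_Mapping.keys \<mu>. Poly_Mapping.single \<rho> (1::nat)"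
  have "\<mu> = (\<mu> - ?s) + ?s"
    by (rule poly_mapping_eqI) (auto simp: lookup_add lookup_minus lookup_sum_single in_keys_iff)
  then have "cmon \<mu> = cmon (\<mu> - ?s) * cmon ?s" by (metis cmon_add)
  then show ?thesis by (auto simp: monom_cmon)
qed

lemma monom_hom_deg: "finite R \<Longrightarrow> hom_deg (card R) (monom R)"
  unfolding monom_def by (rule hom_deg_prod) (auto intro: hom_deg_Var)

text \<open>Stated as closure of an additive subgroup V, so that it can prove both membership facts
  and equality of functionals. A repeated ray of a cone monomial is exchanged once for rays outside
  the cone: the degree is kept and the support grows, which can happen only finitely often.\<close>

lemma squarefree_span:
  assumes add: "\<And>f g. f \<in> V \<Longrightarrow> g \<in> V \<Longrightarrow> f + g \<in> V"
    and neg: "\<And>f. f \<in> V \<Longrightarrow> - f \<in> V"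
    and ideal: "ideal_of (chow_rels m a) \<subseteq> V"
    and cone: "\<And>R. is_cone m a R \<Longrightarrow> card R = d \<Longrightarrow> monom R \<in> V"
    and f: "hom_deg d f"
  shows "f \<in> V"
proof -
  have zero: "0 \<in> V" using ideal ideal_of.zero by blast
  have sum: "sum h A \<in> V" if "\<And>i. i \<in> A \<Longrightarrow> h i \<in> V" for h :: "'x \<Rightarrow> cpoly" and A
    using that by (induction A rule: infinite_finite_induct) (auto intro: add zero)
  have mult: "of_int c * g \<in> V" if "g \<in> V" for c g
  proof (induction c rule: int_induct[where k = 0])
    case base
    then show ?case by (simp add: zero)
  next
    case (step1 i)
    have "of_int (i + 1) * g = of_int i * g + g" by (simp add: algebra_simps)
    then show ?case using add[OF step1(2) that] by simp
  next
    case (step2 i)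
    have "of_int (i - 1) * g = of_int i * g + - g" by (simp add: algebra_simps)
    then show ?case using add[OF step2(2) neg[OF that]] by simp
  qed
  have mon: "cmon \<mu> \<in> V" if "mdeg \<mu> = d" for \<mu>
    using that
  proof (induction "d - card (Poly_Mapping.keys \<mu>)" arbitrary: \<mu> rule: less_induct)
    case less
    show ?case
    proof (cases "is_cone m a (Poly_Mapping.keys \<mu>)")
      case False
      then have "monom (Poly_Mapping.keys \<mu>) \<in> ideal_of (chow_rels m a)"
        by (intro ideal_of_gen) (auto simp: chow_rels_def)
      moreover obtain \<nu> where "cmon \<mu> = cmon \<nu> * monom (Poly_Mapping.keys \<mu>)"
        using cmon_dvd_support by blast
      ultimately show ?thesis using ideal ideal_of_mult by auto
    next
      case True
      then obtain I C where IC: "compatible m a I C" "Poly_Mapping.keys \<mu> = cone_rays I C"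
        by (auto simp: is_cone_def)
      show ?thesis
      proof (cases "\<forall>\<rho>\<in>Poly_Mapping.keys \<mu>. Poly_Mapping.lookup \<mu> \<rho> = 1")
        case sf: True
        have "\<mu> = (\<Sum>\<rho>\<in>Poly_Mapping.keys \<mu>. Poly_Mapping.single \<rho> 1)"
          by (rule poly_mapping_eqI) (use sf in \<open>auto simp: lookup_sum_single in_keys_iff\<close>)
        then have "cmon \<mu> = monom (Poly_Mapping.keys \<mu>)" using monom_cmon[OF finite_keys] by metis
        moreover have "card (Poly_Mapping.keys \<mu>) = d" using less.prems sf by (simp add: mdeg_def)
        ultimately show ?thesis using cone[OF True] by simp
      next
        case False
        then obtain \<rho> where \<rho>: "\<rho> \<in> Poly_Mapping.keys \<mu>" "2 \<le> Poly_Mapping.lookup \<mu> \<rho>"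
          by (metis One_nat_def Suc_1 in_keys_iff le_antisym not_less_eq_eq le_zero_eq)
        define \<nu> where "\<nu> = \<mu> - Poly_Mapping.single \<rho> 1"
        have \<mu>: "\<mu> = Poly_Mapping.single \<rho> 1 + \<nu>"
          by (rule poly_mapping_eqI) (use \<rho> in \<open>auto simp: \<nu>_def lookup_add lookup_minus lookup_single when_def\<close>)
        have keys\<nu>: "Poly_Mapping.keys \<nu> = Poly_Mapping.keys \<mu>"
          using \<rho> by (auto simp: \<nu>_def in_keys_iff lookup_minus lookup_single when_def split: if_splits)
        have tot\<nu>: "Suc (mdeg \<nu>) = d" using less.prems \<mu> by (simp add: mdeg_add mdeg_single)
        have Var_mult: "Var \<sigma> * cmon \<nu> = cmon (Poly_Mapping.single \<sigma> 1 + \<nu>)" for \<sigma>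
          by (simp add: cmon_add) (simp add: cmon_def Var_def)
        have step: "Var \<sigma> * cmon \<nu> \<in> V" if "\<sigma> \<notin> cone_rays I C" for \<sigma>
        proof -
          have k: "Poly_Mapping.keys (Poly_Mapping.single \<sigma> 1 + \<nu>) = insert \<sigma> (Poly_Mapping.keys \<mu>)"
            unfolding keys\<nu>[symmetric] by (auto simp: in_keys_iff lookup_add lookup_single when_def split: if_splits)
          have "\<sigma> \<notin> Poly_Mapping.keys \<mu>" using that IC by simp
          then have card: "card (Poly_Mapping.keys (Poly_Mapping.single \<sigma> 1 + \<nu>)) = Suc (card (Poly_Mapping.keys \<mu>))"
            unfolding k by simp
          have tot: "mdeg (Poly_Mapping.single \<sigma> 1 + \<nu>) = d"
            using tot\<nu> by (simp add: mdeg_add mdeg_single)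
          \<comment> \<open>The support never exceeds the degree d, so the natural difference d
            minus its size strictly decreases.\<close>
          show ?thesis unfolding Var_mult
            by (rule less.hyps) (use card tot mdeg_ge_card[of "Poly_Mapping.single \<sigma> 1 + \<nu>"] in auto)
        qed
        obtain A B where AB: "finite A" "finite B" "A \<inter> cone_rays I C = {}" "B \<inter> cone_rays I C = {}"
          "Var \<rho> - (sum Var A - sum Var B) \<in> ideal_of (chow_rels m a)"
          using cone_ray_exchange[OF IC(1)] \<rho>(1) IC(2) by metis
        have "(\<Sum>\<sigma>\<in>A. Var \<sigma> * cmon \<nu>) \<in> V" "(\<Sum>\<sigma>\<in>B. Var \<sigma> * cmon \<nu>) \<in> V"
          using AB(3,4) by (auto intro!: sum step)
        moreover have "cmon \<nu> * (Var \<rho> - (sum Var A - sum Var B)) \<in> V"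
          using ideal ideal_of_mult[OF AB(5)] by blast
        ultimately have "cmon \<nu> * (Var \<rho> - (sum Var A - sum Var B))
            + ((\<Sum>\<sigma>\<in>A. Var \<sigma> * cmon \<nu>) + - (\<Sum>\<sigma>\<in>B. Var \<sigma> * cmon \<nu>)) \<in> V"
          by (intro add neg)
        also have "cmon \<nu> * (Var \<rho> - (sum Var A - sum Var B))
            + ((\<Sum>\<sigma>\<in>A. Var \<sigma> * cmon \<nu>) + - (\<Sum>\<sigma>\<in>B. Var \<sigma> * cmon \<nu>)) = Var \<rho> * cmon \<nu>"
          by (simp add: algebra_simps flip: sum_distrib_right)
        finally show ?thesis unfolding Var_mult \<mu>[symmetric] .
      qed
    qed
  qed
  have "f = (\<Sum>\<mu>\<in>Poly_Mapping.keys f. of_int (Poly_Mapping.lookup f \<mu>) * cmon \<mu>)"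
    unfolding cmon_def single_eq_of_int_mult[symmetric] by (rule poly_mapping_expand)
  also have "\<dots> \<in> V" using f by (intro sum mult mon) (simp add: hom_deg_iff)
  finally show ?thesis .
qed

section \<open>Bergman classes\<close>

text \<open>In a maximal cone with \<open>C \<noteq> {}\<close> the least member of the chain is the set \<open>A\<close> of full
  fibres, and the next member exceeds \<open>A\<close> by one element \<open>b\<close>. Trading the ray of \<open>A\<close> for a
  point of the fibre over \<open>b\<close> shortens the chain.\<close>

lemma maximal_cone_point:
  assumes "compatible m a I C" "card I + card C = card (Etil m a)"
  shows "monom (cone_rays I C) - monom (Pos ` Etil m a) \<in> ideal_of (chow_rels m a)"
  using assms
proof (induction "card C" arbitrary: I C)
  case 0
  then have "C = {}" "I = Etil m a"
    using compatible_finite[OF 0(2)] compatible_subsets[OF 0(2)] card_subset_eq[OF finite_Etil] by auto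
  then show ?case by (simp add: cone_rays_def ideal_of.zero)
next
  case (Suc k)
  note comp = Suc.prems(1)
  note I = compatible_subsets[OF comp] and proper = compatible_proper[OF comp]
    and chain = compatible_chain[OF comp]
  have fin: "finite I" "finite C" using compatible_finite[OF comp] by auto
  define A where "A = {i \<in> {1..m}. preim m a {i} \<subseteq> I}"
  define B where "B = {1..m} - A"
  have AE: "A \<subseteq> {1..m}" by (auto simp: A_def)
  have finA: "finite A" using AE finite_subset by blast
  have A_sub: "A \<subseteq> F" if "F \<in> C" for F
    using compatible_full[OF comp _ _ that] by (auto simp: A_def)
  \<comment> \<open>Each element with a non-full fibre has a point off I, and there are
    \<open>card C\<close> points off I, hence \<open>card B \<le> card C\<close>. The chain from A
    up to the ground set has at most \<open>card B + 1\<close> members, so equality holds and the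
    cardinalities from \<open>card A\<close> to m all occur.\<close>
  have "B \<subseteq> fst ` (Etil m a - I)"
    unfolding B_def A_def preim_def by (auto simp: image_iff)
  then have "card B \<le> card (fst ` (Etil m a - I))"
    by (intro card_mono) (use finite_Etil in auto)
  also have "\<dots> \<le> card (Etil m a - I)" by (rule card_image_le) (use finite_Etil in auto)
  also have "\<dots> = card C" using Suc.prems(2) card_Diff_subset[OF fin(1) I] by simp
  finally have BC: "card B \<le> card C" .
  have cardB: "card B + card A = m"
    unfolding B_def using card_Diff_subset[OF finA AE] card_mono[OF _ AE] by simp
  have inj: "inj_on card (insert {1..m} C)"
  proof (rule inj_onI)
    fix F G assume FG: "F \<in> insert {1..m} C" "G \<in> insert {1..m} C" "card F = card G"
    then have "finite F" "finite G" using proper finite_subset[of _ "{1..m}"] by auto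
    moreover have "F \<subseteq> G \<or> G \<subseteq> F" using FG chain proper by blast
    ultimately show "F = G" using FG(3) card_subset_eq by metis
  qed
  have EC: "{1..m} \<notin> C" using proper by blast
  have sub: "card ` insert {1..m} C \<subseteq> {card A..m}"
  proof (rule image_subsetI)
    fix F assume "F \<in> insert {1..m} C"
    then have "A \<subseteq> F" "F \<subseteq> {1..m}" using A_sub AE proper by auto
    then show "card F \<in> {card A..m}"
      using card_mono[of F A] card_mono[of "{1..m}" F] finite_subset by auto
  qed
  have "card (card ` insert {1..m} C) = Suc (card C)"
    using card_image[OF inj] EC fin by simp
  then have img: "card ` insert {1..m} C = {card A..m}"
    using BC cardB card_mono[OF _ sub] by (intro card_subset_eq[OF _ sub]) auto
  have cardC: "card C = card B"
    using \<open>card (card ` insert {1..m} C) = Suc (card C)\<close> cardB unfolding img by simp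
  have "card A \<in> card ` insert {1..m} C" unfolding img using cardB by simp
  then obtain F1 where F1: "F1 \<in> insert {1..m} C" "card F1 = card A" by (metis imageE)
  have "F1 = A"
  proof (rule card_subset_eq[symmetric])
    show "finite F1" "A \<subseteq> F1" using F1 A_sub AE proper finite_subset[of _ "{1..m}"] by auto
  qed (use F1 in simp)
  moreover have "card A \<noteq> m" using cardC cardB Suc.hyps(2) by linarith
  then have "A \<noteq> {1..m}" by (metis card_atLeastAtMost diff_Suc_1)
  ultimately have AC: "A \<in> C" using F1 by auto
  have "Suc (card A) \<in> card ` insert {1..m} C"
    unfolding img using cardB cardC Suc.hyps(2) by simp
  then obtain F2 where F2: "F2 \<in> insert {1..m} C" "card F2 = Suc (card A)" by (metis imageE)
  have F2E: "F2 \<subseteq> {1..m}" using F2 proper by auto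
  have AF2: "A \<subseteq> F2" using F2 A_sub AE by auto
  have "card (F2 - A) = 1" using F2 card_Diff_subset[OF finA AF2] by simp
  then obtain b where b: "F2 - A = {b}" by (auto simp: card_1_singleton_iff)
  have F2_eq: "F2 = insert b A" and bA: "b \<notin> A" and bE: "b \<in> {1..m}"
    using b AF2 F2E by auto
  obtain j where j: "j \<in> Etil m a" "fst j = b" "j \<notin> I"
    using compatible_not_full[OF comp bE AC bA] by blast
  define C' where "C' = C - {A}"
  have C': "C = insert A C'" "A \<notin> C'" "finite C'" using AC fin by (auto simp: C'_def)
  have F2_le: "F2 \<subseteq> F" if "F \<in> C'" for F
  proof -
    have F: "F \<in> C" "F \<noteq> A" using that by (auto simp: C'_def)
    have "F \<subseteq> F2 \<or> F2 \<subseteq> F" using F2(1) F(1) chain proper by blast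
    then show ?thesis using A_sub[OF F(1)] F(2) F2_eq by blast
  qed
  \<comment> \<open>Adding j can complete only the fibre over b, and every remaining chain member
    contains F2, hence b.\<close>
  have comp': "compatible m a (insert j I) C'"
    unfolding compatible_def
  proof (intro conjI allI impI ballI)
    show "insert j I \<subseteq> Etil m a" using j I by auto
    show "F \<subset> {1..m}" if "F \<in> C'" for F using that C' proper by auto
    show "F \<subseteq> G \<or> G \<subseteq> F" if "F \<in> C'" "G \<in> C'" for F G using that C' chain by blast
    show "X \<subseteq> F" if X: "X \<subseteq> {1..m}" "preim m a X \<subseteq> insert j I" "F \<in> C'" for X F
    proof
      fix i assume i: "i \<in> X"
      show "i \<in> F"
      proof (cases "i = b")
        case True
        then show ?thesis using F2_le[OF X(3)] F2_eq by auto
      next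
        case False
        then have "preim m a {i} \<subseteq> I" using X i j by (auto simp: preim_def)
        then have "i \<in> A" using X i by (auto simp: A_def)
        then show ?thesis using A_sub C' X(3) by blast
      qed
    qed
  qed
  have "monom (cone_rays (insert j I) C') - monom (Pos ` Etil m a) \<in> ideal_of (chow_rels m a)"
    using Suc.prems(2) Suc.hyps(2) C' fin j by (intro Suc.hyps(1) comp') auto
  moreover have "monom (cone_rays I C) - monom (cone_rays (insert j I) C') \<in> ideal_of (chow_rels m a)"
  proof -
    let ?R = "cone_rays I C'"
    let ?D = "{S. S \<subset> {1..m} \<and> b \<notin> S \<and> S \<noteq> A}"
    have finR: "finite ?R" using fin C' by (simp add: finite_cone_rays)
    have split: "(\<Sum>S | S \<subset> {1..m} \<and> b \<notin> S. Var (Neg S)) = Var (Neg A) + (\<Sum>S\<in>?D. Var (Neg S))"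
      using AC proper bA by (subst sum.remove[of _ A]) (auto intro!: finite_Neg sum.cong)
    have mA: "Var (Neg A) * monom ?R = monom (cone_rays I C)"
    proof -
      have "cone_rays I C = insert (Neg A) ?R" "Neg A \<notin> ?R"
        using C' by (auto simp: cone_rays_def)
      then show ?thesis using finR by (simp add: monom_def)
    qed
    have mj: "Var (Pos j) * monom ?R = monom (cone_rays (insert j I) C')"
    proof -
      have "cone_rays (insert j I) C' = insert (Pos j) ?R" "Pos j \<notin> ?R"
        using j by (auto simp: cone_rays_def)
      then show ?thesis using finR by (simp add: monom_def)
    qed
    \<comment> \<open>A cone with S in the chain would need A inside S and S inside F2, which is A
      with b added; since S misses b this forces S = A.\<close>
    have mS: "Var (Neg S) * monom ?R \<in> ideal_of (chow_rels m a)" if S: "S \<in> ?D" for S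
    proof -
      have SC: "S \<notin> C'" using S F2_le F2_eq by blast
      have eq: "cone_rays I (insert S C') = insert (Neg S) ?R" "Neg S \<notin> ?R"
        using SC by (auto simp: cone_rays_def)
      have "\<not> is_cone m a (cone_rays I (insert S C'))"
      proof
        assume "is_cone m a (cone_rays I (insert S C'))"
        then have compS: "compatible m a I (insert S C')"
          by (auto simp: is_cone_def cone_rays_eq_iff)
        have "A \<subseteq> S" using compatible_full[OF compS] by (auto simp: A_def)
        moreover have "S \<subseteq> F2"
        proof (cases "F2 = {1..m}")
          case False
          then have "F2 \<in> C'" using F2 F2_eq bA by (auto simp: C'_def)
          then have "S \<subseteq> F2 \<or> F2 \<subseteq> S" using compatible_chain[OF compS] by blast
          then show ?thesis using S F2_eq by blast
        qed (use S in auto)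
        ultimately show False using S F2_eq by blast
      qed
      then have "monom (cone_rays I (insert S C')) \<in> ideal_of (chow_rels m a)"
        using finR unfolding eq by (intro ideal_of_gen) (auto simp: chow_rels_def)
      then show ?thesis using finR eq by (simp add: monom_def)
    qed
    have "monom ?R * (Var (Pos j) - (\<Sum>S | S \<subset> {1..m} \<and> fst j \<notin> S. Var (Neg S))) \<in> ideal_of (chow_rels m a)"
      by (intro ideal_of_mult linear_relation j)
    moreover have "(\<Sum>S\<in>?D. Var (Neg S) * monom ?R) \<in> ideal_of (chow_rels m a)"
      by (rule ideal_of_sum) (rule mS)
    ultimately have "- (monom ?R * (Var (Pos j) - (\<Sum>S | S \<subset> {1..m} \<and> fst j \<notin> S. Var (Neg S))))
       - (\<Sum>S\<in>?D. Var (Neg S) * monom ?R) \<in> ideal_of (chow_rels m a)"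
      by (intro ideal_of_diff ideal_of_uminus)
    also have "- (monom ?R * (Var (Pos j) - (\<Sum>S | S \<subset> {1..m} \<and> fst j \<notin> S. Var (Neg S))))
       - (\<Sum>S\<in>?D. Var (Neg S) * monom ?R) = monom (cone_rays I C) - monom (cone_rays (insert j I) C')"
      unfolding j(2) split mA[symmetric] mj[symmetric] sum_distrib_right[symmetric]
      by (simp add: algebra_simps)
    finally show ?thesis .
  qed
  ultimately show ?case using ideal_of_add by fastforce
qed

section \<open>The free polymatroid and the toric degree map\<close>

definition free_rank :: "(nat \<Rightarrow> nat) \<Rightarrow> nat set \<Rightarrow> nat" where
  "free_rank a A = (\<Sum>i\<in>A. a i)"

lemma free_rank_mono: "A \<subseteq> B \<Longrightarrow> B \<subseteq> {1..m} \<Longrightarrow> free_rank a A \<le> free_rank a B"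
  unfolding free_rank_def by (rule sum_mono2) (auto intro: finite_subset)

lemma free_rank_modular:
  "A \<subseteq> {1..m} \<Longrightarrow> B \<subseteq> {1..m} \<Longrightarrow> free_rank a (A \<union> B) + free_rank a (A \<inter> B) = free_rank a A + free_rank a B"
  unfolding free_rank_def by (rule sum.union_inter) (auto intro: finite_subset)

lemma polymatroid_free: "polymatroid m a (free_rank a)"
  unfolding polymatroid_def
  using free_rank_mono[of _ _ m a] free_rank_modular[of _ m _ a] by (auto simp: free_rank_def)

lemma card_Etil_free: "card (Etil m a) = free_rank a {1..m}"
  by (simp add: card_Etil free_rank_def)

text \<open>The normalisation. As the functional kills the ideal, it also shows that no nonzero
  integer multiple of the point class lies in the ideal, so the integer in \<open>deg_X\<close> is
  unique.\<close>

lemma hdeg_point: "hdeg m (free_rank a) (to_h m a (monom (Pos ` Etil m a))) = 1"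
proof -
  have "card T \<le> free_rank a (fst ` T)" if T: "T \<subseteq> Etil m a" for T
  proof -
    have "T \<subseteq> preim m a (fst ` T)" using T by (auto simp: preim_def)
    then have "card T \<le> card (preim m a (fst ` T))"
      by (intro card_mono) (auto simp: preim_def finite_Etil)
    then show ?thesis using card_preim[OF fst_Etil[OF T], of a] by (simp add: free_rank_def)
  qed
  then have "hdeg m (free_rank a) (to_h m a (monom (cone_rays (Etil m a) {}))) = 1"
    using hdeg_cone[OF polymatroid_free, of "Etil m a" m a "{}"] card_Etil_free[of m a]
    by (subst to_h_cone) auto
  then show ?thesis by (simp add: cone_rays_def)
qed

lemma top_degree_point:
  assumes "hom_deg (card (Etil m a)) f"
  obtains c where "f - of_int c * monom (Pos ` Etil m a) \<in> ideal_of (chow_rels m a)"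
proof -
  let ?J = "ideal_of (chow_rels m a)" and ?p = "monom (Pos ` Etil m a)"
  define V where "V = {f. \<exists>c. f - of_int c * ?p \<in> ?J}"
  have "f \<in> V"
  proof (rule squarefree_span[OF _ _ _ _ assms])
    show "f + g \<in> V" if fg: "f \<in> V" "g \<in> V" for f g
    proof -
      obtain c d where "f - of_int c * ?p \<in> ?J" "g - of_int d * ?p \<in> ?J"
        using fg by (auto simp: V_def)
      then have "(f - of_int c * ?p) + (g - of_int d * ?p) \<in> ?J" by (rule ideal_of_add)
      then have "f + g - of_int (c + d) * ?p \<in> ?J" by (simp add: algebra_simps)
      then show ?thesis unfolding V_def by blast
    qed
    show "- f \<in> V" if fV: "f \<in> V" for f
    proof -
      obtain c where "f - of_int c * ?p \<in> ?J" using fV by (auto simp: V_def)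
      then have "- (f - of_int c * ?p) \<in> ?J" by (rule ideal_of_uminus)
      then have "- f - of_int (- c) * ?p \<in> ?J" by (simp add: algebra_simps)
      then show ?thesis unfolding V_def by blast
    qed
    show "?J \<subseteq> V"
    proof
      fix f assume "f \<in> ?J"
      then have "f - of_int 0 * ?p \<in> ?J" by simp
      then show "f \<in> V" unfolding V_def by blast
    qed
    fix R assume "is_cone m a R" "card R = card (Etil m a)"
    then obtain I C where "compatible m a I C" "R = cone_rays I C" "card I + card C = card (Etil m a)"
      using compatible_finite card_cone_rays by (metis is_cone_def)
    then have "monom R - of_int 1 * ?p \<in> ?J" using maximal_cone_point[of m a I C] by simp
    then show "monom R \<in> V" unfolding V_def by blast
  qed
  then show ?thesis using that unfolding V_def by blast
qed

lemma hdeg_of_int_mult: "hdeg m rk (of_int c * f) = c * hdeg m rk f"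
  by (simp add: hdeg_def lin_of_int_mult)

lemma hdeg_diff: "hdeg m rk (f - g) = hdeg m rk f - hdeg m rk g"
  by (simp add: hdeg_def lin_diff)

text \<open>Existence of the integer comes from spanning by the point class, uniqueness from the
  functional with value 1 there; together they make the description in \<open>deg_X\<close>
  meaningful in top degree.\<close>

lemma deg_X_eq_hdeg:
  assumes "hom_deg (card (Etil m a)) f"
  shows "deg_X m a f = hdeg m (free_rank a) (to_h m a f)"
proof -
  have eq: "hdeg m (free_rank a) (to_h m a f) = c"
    if "f - of_int c * monom (Pos ` Etil m a) \<in> ideal_of (chow_rels m a)" for c
    using hdeg_ideal[OF polymatroid_free that]
    by (simp add: to_h_diff to_h_of_int_mult hdeg_diff hdeg_of_int_mult hdeg_point)
  obtain c where c: "f - of_int c * monom (Pos ` Etil m a) \<in> ideal_of (chow_rels m a)"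
    using top_degree_point[OF assms] .
  show ?thesis
    unfolding deg_X_def eq[OF c] by (rule the_equality) (use c eq in auto)
qed


section \<open>Higgs lifts and a representative of the Bergman class\<close>

lemma polymatroid_le_free:
  assumes P: "polymatroid m a rk" and "A \<subseteq> {1..m}"
  shows "rk A \<le> free_rank a A"
proof -
  have "finite A" using assms(2) finite_subset by blast
  then show ?thesis using assms(2)
  proof (induction A)
    case empty
    then show ?case by (simp add: polymatroid_empty[OF P])
  next
    case (insert i A)
    have "rk ({i} \<union> A) + rk ({i} \<inter> A) \<le> rk {i} + rk A"
      by (rule polymatroid_submod[OF P]) (use insert in auto)
    moreover have "rk {i} \<le> a i" using insert by (intro polymatroid_singleton[OF P]) auto
    ultimately show ?case using insert by (simp add: free_rank_def)
  qed
qed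

text \<open>The Higgs lifts interpolate between a polymatroid and the free polymatroid of the same type.\<close>

definition lift_rank :: "(nat \<Rightarrow> nat) \<Rightarrow> (nat set \<Rightarrow> nat) \<Rightarrow> nat \<Rightarrow> nat set \<Rightarrow> nat" where
  "lift_rank a rk s A = min (rk A + s) (free_rank a A)"

text \<open>Monotonicity of the nullity \<open>free_rank a A - rk A\<close>, written additively to
  stay clear of natural subtraction. It makes the sets where consecutive lifts differ upward
  closed.\<close>

lemma corank_mono:
  assumes P: "polymatroid m a rk" and AB: "A \<subseteq> B" "B \<subseteq> {1..m}"
  shows "rk B + free_rank a A \<le> rk A + free_rank a B"
proof -
  have BA: "A \<union> (B - A) = B" "A \<inter> (B - A) = {}" "A \<subseteq> {1..m}" "B - A \<subseteq> {1..m}"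
    using AB by auto
  have "rk B \<le> rk A + rk (B - A)"
    using polymatroid_submod[OF P BA(3,4)] unfolding BA(1) by simp
  moreover have "rk (B - A) \<le> free_rank a (B - A)"
    by (rule polymatroid_le_free[OF P BA(4)])
  moreover have "free_rank a B = free_rank a A + free_rank a (B - A)"
    using free_rank_modular[OF BA(3,4), of a] unfolding BA(1,2) by (simp add: free_rank_def)
  ultimately show ?thesis by simp
qed

lemma polymatroid_lift:
  assumes P: "polymatroid m a rk"
  shows "polymatroid m a (lift_rank a rk s)"
  unfolding polymatroid_def
proof (intro conjI allI impI ballI)
  show "lift_rank a rk s {} = 0" by (simp add: lift_rank_def free_rank_def)
  show "lift_rank a rk s {i} \<le> a i" for i by (simp add: lift_rank_def free_rank_def)
  show "lift_rank a rk s A \<le> lift_rank a rk s B" if "A \<subseteq> B" "B \<subseteq> {1..m}" for A B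
    using polymatroid_mono[OF P that] free_rank_mono[OF that, of a] by (auto simp: lift_rank_def)
  show "lift_rank a rk s (A \<union> B) + lift_rank a rk s (A \<inter> B) \<le> lift_rank a rk s A + lift_rank a rk s B"
    if AB: "A \<subseteq> {1..m}" "B \<subseteq> {1..m}" for A B
  proof -
    have "A \<union> B \<subseteq> {1..m}" using AB by auto
    \<comment> \<open>These two inequalities handle the mixed cases, where one minimum on the right
      is the shifted rank and the other the free rank.\<close>
    then have "rk (A \<union> B) + free_rank a A \<le> rk A + free_rank a (A \<union> B)"
      "rk (A \<union> B) + free_rank a B \<le> rk B + free_rank a (A \<union> B)"
      by (intro corank_mono[OF P]; auto)+
    then show ?thesis
      using polymatroid_submod[OF P AB] free_rank_modular[OF AB, of a] unfolding lift_rank_def by linarith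
  qed
qed

text \<open>The sum runs over the proper subsets on which the lifts for s and \<open>Suc s\<close>
  agree, as required for passing from the latter to the former by an elementary quotient.\<close>

definition lift_divisor :: "nat \<Rightarrow> (nat \<Rightarrow> nat) \<Rightarrow> (nat set \<Rightarrow> nat) \<Rightarrow> nat \<Rightarrow> cpoly" where
  "lift_divisor m a rk s = (\<Sum>T | T \<subset> {1..m} \<and> \<not> rk T + s < free_rank a T. x_S T)"

lemma hr_cong: "(\<And>A. A \<subseteq> {1..m} \<Longrightarrow> rk A = rk' A) \<Longrightarrow> \<forall>S\<in>#M. S \<subseteq> {1..m} \<Longrightarrow> hr rk M \<longleftrightarrow> hr rk' M"
  unfolding hr_def using Union_mset_subset[of M "{1..m}"] by auto

lemma hdeg_cong:
  assumes "\<And>A. A \<subseteq> {1..m} \<Longrightarrow> rk A = rk' A"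
  shows "hdeg m rk = hdeg m rk'"
proof -
  have "hr_weight m rk = hr_weight m rk'"
    unfolding hr_weight_def using hr_cong[OF assms] assms[of "{1..m}"] by (intro ext if_cong) auto
  then show ?thesis by (simp add: hdeg_def)
qed

lemma hdeg_lift:
  assumes P: "polymatroid m a rk" and "k \<le> free_rank a {1..m} - rk {1..m}"
  shows "hdeg m (lift_rank a rk k) ((\<Prod>s<k. to_h m a (lift_divisor m a rk s)) * f) = hdeg m rk f"
  using assms(2)
proof (induction k arbitrary: f)
  case 0
  have "hdeg m (lift_rank a rk 0) = hdeg m rk"
    by (rule hdeg_cong) (simp add: lift_rank_def polymatroid_le_free[OF P])
  then show ?case by simp
next
  case (Suc k)
  let ?\<delta> = "\<lambda>A. rk A + k < free_rank a A"
  have D: "to_h m a (lift_divisor m a rk k) = (\<Sum>T | T \<subset> {1..m} \<and> \<not> ?\<delta> T. xpoly m T)"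
    unfolding lift_divisor_def x_S_def to_h_sum to_h_Var by (intro sum.cong) (auto simp: lbl_poly_def)
  have "hdeg m (lift_rank a rk (Suc k)) ((\<Sum>T | T \<subset> {1..m} \<and> \<not> ?\<delta> T. xpoly m T) * g) = hdeg m (lift_rank a rk k) g" for g
  proof (rule hdeg_elementary_quotient[OF polymatroid_lift[OF P] polymatroid_lift[OF P]])
    show "lift_rank a rk (Suc k) A = lift_rank a rk k A + (if ?\<delta> A then 1 else 0)" for A
      by (auto simp: lift_rank_def)
    show "?\<delta> B" if "A \<subseteq> B" "B \<subseteq> {1..m}" "?\<delta> A" for A B
      using corank_mono[OF P that(1,2)] that(3) by linarith
    \<comment> \<open>The bound on k enters here: the total rank drops at each of these
      steps.\<close>
    show "?\<delta> {1..m}" using Suc.prems by linarith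
  qed
  moreover have "(\<Prod>s<Suc k. to_h m a (lift_divisor m a rk s)) * f =
      (\<Sum>T | T \<subset> {1..m} \<and> \<not> ?\<delta> T. xpoly m T) * ((\<Prod>s<k. to_h m a (lift_divisor m a rk s)) * f)"
    unfolding D[symmetric] by (simp add: mult_ac)
  ultimately show ?case using Suc.IH[of f] Suc.prems by (simp only: Suc_leD)
qed

definition bergman_rep :: "nat \<Rightarrow> (nat \<Rightarrow> nat) \<Rightarrow> (nat set \<Rightarrow> nat) \<Rightarrow> cpoly" where
  "bergman_rep m a rk = (\<Prod>s<free_rank a {1..m} - rk {1..m}. lift_divisor m a rk s)"

lemma hom_deg_bergman_rep: "hom_deg (free_rank a {1..m} - rk {1..m}) (bergman_rep m a rk)"
  unfolding bergman_rep_def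
  using hom_deg_prod[of "{..<free_rank a {1..m} - rk {1..m}}" "lift_divisor m a rk"]
  by (auto simp: lift_divisor_def x_S_def intro!: hom_deg_sum hom_deg_Var)

lemma hdeg_bergman_rep:
  assumes P: "polymatroid m a rk"
  shows "hdeg m (free_rank a) (to_h m a (f * bergman_rep m a rk)) = hdeg m rk (to_h m a f)"
proof -
  let ?k = "free_rank a {1..m} - rk {1..m}"
  \<comment> \<open>No subset has larger nullity than the whole ground set, so lifting by that
    amount reaches the free polymatroid.\<close>
  have "hdeg m (free_rank a) = hdeg m (lift_rank a rk ?k)"
  proof (rule hdeg_cong)
    fix A :: "nat set" assume A: "A \<subseteq> {1..m}"
    show "free_rank a A = lift_rank a rk ?k A"
      using corank_mono[OF P A] polymatroid_le_free[OF P, of "{1..m}"] by (auto simp: lift_rank_def)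
  qed
  then show ?thesis
    using hdeg_lift[OF P order_refl, of "to_h m a f"]
    by (simp add: to_h_mult bergman_rep_def to_h_prod mult.commute)
qed

lemma hdeg_rank_cone:
  assumes P: "polymatroid m a rk" and R: "is_cone m a R" "card R = rk {1..m}"
  shows "hdeg m rk (to_h m a (monom R)) = (if in_SigmaP m a rk R then 1 else 0)"
proof -
  obtain I C where IC: "compatible m a I C" "R = cone_rays I C" using R(1) by (auto simp: is_cone_def)
  note I = compatible_subsets[OF IC(1)] and C = compatible_proper[OF IC(1)] compatible_chain[OF IC(1)]
  have card: "card I + card C = rk {1..m}"
    using R(2) IC compatible_finite[OF IC(1)] card_cone_rays by metis
  \<comment> \<open>The condition for the last member of the chain, the ground set itself, is
    vacuous.\<close>
  have all: "I - preim m a {1..m} = {}" using I by (auto simp: preim_def Etil_def)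
  have unique: "(\<exists>I' C'. compatible m a I' C' \<and> (I = I' \<and> C = C') \<and> P I' C') \<longleftrightarrow> P I C" for P
    using IC(1) by blast
  have "in_SigmaP m a rk R \<longleftrightarrow> (\<forall>F\<in>C. is_flat m rk F) \<and> (\<forall>T \<subseteq> I. rk (fst ` T) \<ge> card T) \<and>
        (\<forall>F \<in> insert {1..m} C. \<forall>T. T \<subseteq> I - preim m a F \<longrightarrow> T \<noteq> {} \<longrightarrow>
            rk (F \<union> fst ` T) > rk F + card T)"
    unfolding in_SigmaP_def IC(2) cone_rays_eq_iff by (rule unique)
  also have "\<dots> \<longleftrightarrow> (\<forall>T\<subseteq>I. card T \<le> rk (fst ` T)) \<and> (\<forall>F\<in>C. is_flat m rk F \<and>
       (\<forall>T. T \<subseteq> I - preim m a F \<longrightarrow> T \<noteq> {} \<longrightarrow> rk F + card T < rk (F \<union> fst ` T)))"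
    unfolding ball_simps(7) all by blast
  finally show ?thesis
    unfolding IC(2) to_h_cone[OF I C(1)] hdeg_cone[OF P I C card] by simp
qed

lemma deg_X_rank_complement:
  assumes P: "polymatroid m a rk" and "hom_deg (rk {1..m}) f"
    and "hom_deg (card (Etil m a) - rk {1..m}) c"
  shows "deg_X m a (f * c) = hdeg m (free_rank a) (to_h m a (f * c))"
  using hom_deg_mult[OF assms(2,3)] polymatroid_le_free[OF P, of "{1..m}"]
  by (intro deg_X_eq_hdeg) (simp add: card_Etil_free)

lemma is_cone_finite: "is_cone m a R \<Longrightarrow> finite R"
  using compatible_finite finite_cone_rays by (metis is_cone_def)

lemma bergman_class_rep:
  assumes P: "polymatroid m a rk"
  shows "bergman_class m a rk (bergman_rep m a rk)"
  unfolding bergman_class_def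
proof (intro conjI allI impI)
  show hom: "hom_deg (card (Etil m a) - rk {1..m}) (bergman_rep m a rk)"
    using hom_deg_bergman_rep by (simp add: card_Etil_free)
  fix R assume R: "is_cone m a R" "card R = rk {1..m}"
  have "hom_deg (rk {1..m}) (monom R)" using monom_hom_deg[OF is_cone_finite[OF R(1)]] R(2) by simp
  then show "deg_X m a (bergman_rep m a rk * monom R) = (if in_SigmaP m a rk R then 1 else 0)"
    using deg_X_rank_complement[OF P _ hom, of "monom R"] hdeg_rank_cone[OF P R]
    by (simp add: hdeg_bergman_rep[OF P] mult.commute)
qed

text \<open>Independence of the representative: both sides are additive in f and vanish on the
  ideal, and on squarefree cone monomials they agree by the definition of a Bergman class and
  \<open>hdeg_rank_cone\<close>.\<close>

lemma deg_X_bergman_class: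
  assumes P: "polymatroid m a rk" and c: "bergman_class m a rk c" and f: "hom_deg (rk {1..m}) f"
  shows "deg_X m a (f * c) = hdeg m rk (to_h m a f)"
proof -
  have hom: "hom_deg (card (Etil m a) - rk {1..m}) c" using c by (simp add: bergman_class_def)
  define V where "V = {f. hdeg m (free_rank a) (to_h m a (f * c)) = hdeg m rk (to_h m a f)}"
  have "f \<in> V"
  proof (rule squarefree_span[OF _ _ _ _ f])
    show "f + g \<in> V" if "f \<in> V" "g \<in> V" for f g
      using that by (simp add: V_def distrib_right to_h_add) (simp add: hdeg_def lin_add)
    show "- f \<in> V" if "f \<in> V" for f
      using that by (simp add: V_def to_h_uminus) (simp add: hdeg_def lin_uminus)
    show "ideal_of (chow_rels m a) \<subseteq> V"
    proof
      fix f assume f: "f \<in> ideal_of (chow_rels m a)"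
      then have "c * f \<in> ideal_of (chow_rels m a)" by (rule ideal_of_mult)
      then show "f \<in> V"
        using f by (simp add: V_def hdeg_ideal[OF P] hdeg_ideal[OF polymatroid_free] mult.commute)
    qed
    fix R assume R: "is_cone m a R" "card R = rk {1..m}"
    have "hom_deg (rk {1..m}) (monom R)" using monom_hom_deg[OF is_cone_finite[OF R(1)]] R(2) by simp
    then have "deg_X m a (monom R * c) = hdeg m (free_rank a) (to_h m a (monom R * c))"
      by (rule deg_X_rank_complement[OF P _ hom])
    moreover have "deg_X m a (c * monom R) = (if in_SigmaP m a rk R then 1 else 0)"
      using c R unfolding bergman_class_def by blast
    ultimately show "monom R \<in> V" by (simp add: V_def hdeg_rank_cone[OF P R] mult.commute)
  qed
  then show ?thesis unfolding deg_X_rank_complement[OF P f hom] by (simp add: V_def)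
qed

lemma deg_P_eq_hdeg:
  assumes P: "polymatroid m a rk" and f: "hom_deg (rk {1..m}) f"
  shows "deg_P m a rk f = hdeg m rk (to_h m a f)"
  unfolding deg_P_def
proof (rule the_equality)
  show "\<forall>c. bergman_class m a rk c \<longrightarrow> deg_X m a (f * c) = hdeg m rk (to_h m a f)"
    using deg_X_bergman_class[OF P _ f] by blast
  \<comment> \<open>Uniqueness rests on the existence of one representative, supplied by
    \<open>bergman_class_rep\<close>.\<close>
  show "d = hdeg m rk (to_h m a f)"
    if "\<forall>c. bergman_class m a rk c \<longrightarrow> deg_X m a (f * c) = d" for d
    using that bergman_class_rep[OF P] deg_X_bergman_class[OF P _ f] by metis
qed

lemma prod_hvar:
  "finite J \<Longrightarrow> \<forall>i\<in>J. S i \<noteq> {} \<Longrightarrow> (\<Prod>i\<in>J. hvar (S i)) = hmon (image_mset S (mset_set J))"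
  by (induction J rule: finite_induct) (auto simp: hmon_empty hvar_def hmon_mult)

lemma hr_image_mset:
  "hr rk (image_mset S (mset_set {1..r})) \<longleftrightarrow> hall_rado rk r S"
proof -
  have fin: "finite J" if "J \<subseteq> {1..r}" for J using that finite_subset by blast
  have "hr rk (image_mset S (mset_set {1..r})) \<longleftrightarrow>
      (\<forall>J\<subseteq>{1..r}. size (image_mset S (mset_set J)) \<le> rk (\<Union> (set_mset (image_mset S (mset_set J)))))"
    unfolding hr_def subseteq_mset_set_image[OF finite_atLeastAtMost] by blast
  also have "\<dots> \<longleftrightarrow> hall_rado rk r S"
    unfolding hall_rado_def using fin by (intro all_cong) simp
  finally show ?thesis .
qed

theorem theorem1p3:
  fixes m r :: nat and a :: "nat \<Rightarrow> nat" and rk :: "nat set \<Rightarrow> nat"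
    and S :: "nat \<Rightarrow> nat set"
  assumes "polymatroid m a rk"
    and "r = rk {1..m}"
    and "\<forall>i\<in>{1..r}. S i \<noteq> {} \<and> S i \<subseteq> {1..m}"
  shows "deg_P m a rk (\<Prod>i\<in>{1..r}. h_S m (S i)) = (if hall_rado rk r S then 1 else 0)"
proof -
  have "hom_deg 1 (h_S m T)" for T
    unfolding h_S_def x_S_def by (intro hom_deg_sum) (simp add: hom_deg_Var)
  then have "hom_deg (rk {1..m}) (\<Prod>i\<in>{1..r}. h_S m (S i))"
    using hom_deg_prod[of "{1..r}" "\<lambda>i. h_S m (S i)"] assms(2) by simp
  then have "deg_P m a rk (\<Prod>i\<in>{1..r}. h_S m (S i)) = hdeg m rk (\<Prod>i\<in>{1..r}. to_h m a (h_S m (S i)))"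
    using deg_P_eq_hdeg[OF assms(1)] by (simp only: to_h_prod)
  also have "(\<Prod>i\<in>{1..r}. to_h m a (h_S m (S i))) = (\<Prod>i\<in>{1..r}. hvar (S i))"
    using assms(3) by (intro prod.cong refl to_h_h_S) auto
  also have "\<dots> = hmon (image_mset S (mset_set {1..r}))"
    using assms(3) by (intro prod_hvar) auto
  also have "hdeg m rk \<dots> = (if hall_rado rk r S then 1 else 0)"
    using assms(2,3) by (auto simp: hr_weight_def hr_image_mset simp del: One_nat_def)
  finally show ?thesis .
qed

end
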